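(* Let $1 \leq z_1 \leq z_2 \leq \ldots$ be an unbounded nondecreasing sequence of real numbers with $\sum_{n=1}^\infty \frac{1}{z_n} < \infty$, and let $f$ be the entire function $$f(z) = \prod_{n=1}^\infty \left(1 - \frac{z}{z_n}\right).$$ Suppose the lower order $\lambda$ and the order $\rho$ of $f$ satisfy $0 < \lambda \leq \rho \leq \frac{1}{2}$. Suppose also that the limit $\mu := \lim_{r \to \infty} \frac{n(r)}{r^\rho}$ exists and satisfies $0 < \mu < \infty$, where $n(r)$ is the number of indices $n$ with $z_n < r$. Let $0 < \phi < \frac{\pi}{2}$, let $d \geq 1$ be an integer, and put $$\alpha = 1 + \rho, \qquad \beta = \frac{\lambda}{2}, \qquad \gamma = \frac{2\alpha + \rho}{\beta \rho}.$$ Then there is a constant $C > 0$ such that for all $H > e$, there are at most $C (\log H)^{\frac{2\alpha(\gamma+1)}{\rho}}$ numbers $z \in \mathbb{C} \setminus S_\phi$ such that $[\mathbb{Q}(z, f(z)) : \mathbb{Q}] \leq d$ and $H(z, f(z)) \leq H$.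
   Context: For an entire function $f$, let $M(r,f) = \max_{|z| = r} |f(z)|$. The order and lower order of $f$ are $$\rho = \limsup_{r \to \infty} \frac{\log \log M(r,f)}{\log r}, \qquad \lambda = \liminf_{r \to \infty} \frac{\log \log M(r,f)}{\log r}.$$ For $0 < \phi < \frac{\pi}{2}$, $S_\phi$ denotes the sector $S_\phi = \{ z \in \mathbb{C} : -\phi \leq \arg z \leq \phi \}$. Height: for a polynomial $P(z) = a \prod_{j=1}^n (z - \alpha_j) \in \mathbb{C}[z]$, the Mahler measure is $\mathcal{M}(P) = |a| \prod_{j=1}^n \max\{1, |\alpha_j|\}$. For an algebraic number $\alpha$ of degree $d$, $\mathcal{M}(\alpha)$ is the Mahler measure of its minimal polynomial over $\mathbb{Z}$, and the absolute multiplicative height is $H(\alpha) = \mathcal{M}(\alpha)^{1/d}$. For algebraic numbers $\alpha, \beta$, $H(\alpha, \beta) = \max\{H(\alpha), H(\beta)\}$. (The symbol $H$ without argument denotes a real number, the height bound.) *)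

theory Defs
  imports
    "HOL-Analysis.Analysis"
    "HOL-Algebra.Algebraic_Closure_Type"
    "HOL-Algebra.Generated_Fields"
    "Berlekamp_Zassenhaus.Mahler_Measure"
begin

definition max_modulus :: "real \<Rightarrow> (complex \<Rightarrow> complex) \<Rightarrow> real" where
  "max_modulus r f = (SUP z\<in>sphere 0 r. cmod (f z))"

(* Every nonconstant entire f has max_modulus r f > 1 for all large r, so the values
   of ln at nonpositive arguments do not affect the two limits below. *)
definition growth_order :: "(complex \<Rightarrow> complex) \<Rightarrow> ereal" where
  "growth_order f = Limsup at_top (\<lambda>r. ereal (ln (ln (max_modulus r f)) / ln r))"

definition growth_lower_order :: "(complex \<Rightarrow> complex) \<Rightarrow> ereal" where
  "growth_lower_order f = Liminf at_top (\<lambda>r. ereal (ln (ln (max_modulus r f)) / ln r))"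

definition counting_fun :: "(nat \<Rightarrow> real) \<Rightarrow> real \<Rightarrow> nat" where
  "counting_fun a r = card {n. a n < r}"

(* Arg takes values in (-pi, pi] and Arg 0 = 0, so the vertex 0 belongs to the sector. *)
definition sector :: "real \<Rightarrow> complex set" where
  "sector \<phi> = {z. -\<phi> \<le> Arg z \<and> Arg z \<le> \<phi>}"

(* The minimal polynomial over the integers. Irreducibility in Z[X] includes primitivity,
   and the sign of the leading coefficient makes the polynomial unique.
   The value is unspecified if x is transcendental. *)
definition min_int_poly :: "complex \<Rightarrow> int poly" where
  "min_int_poly x = (THE p. Factorial_Ring.irreducible p \<and> Polynomial.lead_coeff p > 0 \<and>
                            poly (map_poly of_int p) x = 0)"

definition alg_height :: "complex \<Rightarrow> real" where
  "alg_height x = root (Polynomial.degree (min_int_poly x)) (mahler_measure (min_int_poly x))"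

definition alg_height2 :: "complex \<Rightarrow> complex \<Rightarrow> real" where
  "alg_height2 x y = max (alg_height x) (alg_height y)"

abbreviation complex_ring :: "complex ring" where
  "complex_ring \<equiv> ring_of_type_algebra"

(* The degree [Q(S) : Q]. A field generated inside the complex numbers contains the prime
   field, so generate_field complex_ring S is Q(S). *)
definition degree_over_Q :: "complex set \<Rightarrow> enat" where
  "degree_over_Q S =
     (if ring.finite_dimension complex_ring \<rat> (generate_field complex_ring S)
      then enat (ring.dim complex_ring \<rat> (generate_field complex_ring S))
      else \<infinity>)"

end

(*
  Off the sector the density hypothesis forces growth: for c = cos \<phi> and |z| = r,
  ln |f z| is at least the sum of F (a n / r) with F u = ln (u^2 - 2 c u + 1) / 2 - ln u.
  Abel summation turns the sum into the integral of the counting function against - F', and since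
  - F' changes sign only once, at 1 / c, comparing r^\<rho> with r^(1/2) reduces to \<rho> = 1/2, where there
  is an explicit primitive.  Hence |f z| >= exp (\<eta> |z|^\<rho>), so the points in question lie in a disc
  whose radius is a power of ln H.

  If there are many of them, the pigeonhole principle gives a nonzero integer polynomial P with
  P (z, f z) tiny at some of them, a Liouville inequality makes these values zero, and the Schwarz
  lemma together with the same inequality propagates the zeros to all the points.  At a suitable
  negative integer -m the top coefficient of P in the second variable is a nonzero integer and
  f (-m) is huge, so |P (-m, f (-m))| >= 1; the Schwarz lemma then bounds the number of zeros.
*)
theory Submission
  imports Defs "HOL-Complex_Analysis.Complex_Analysis" "HOL-Real_Asymp.Real_Asymp"
    "Jordan_Normal_Form.Char_Poly" "Berlekamp_Zassenhaus.Factor_Bound"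
begin

text \<open>The Liouville inequality is obtained without number fields or places. If a x^k and b y^l
  are integer combinations of lower powers of x and of y, then multiplication by a x and by b y acts
  on the vector of the monomials x^i y^j (i < k, j < l) through integer matrices. Hence a^T b^T P
  (x, y) is an eigenvalue of an integer matrix with controlled row sums. The resulting exponent d^2
  + 1 only affects constants, since d is fixed. The obstacle in the growth estimate is that Re z may
  be positive outside the sector. Then infinitely many factors of the product have modulus below 1,
  no termwise bound works, and the positive sign of the sum has to come from the density. All sizes
  are tied to one parameter u that bounds both the radius and the logarithm of the height. The
  degree T in each variable and an auxiliary integer M are proportional to u. Prescribing N = (T +
  1) M zeros leaves enough of the (T + 1)^2 coefficients free, and N exceeds the exponents O (T u)
  of the bounds that compete with 4^N.\<close>

section \<open>Integer matrices and a lower bound for values of polynomials\<close>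

text \<open>The product of the nonzero roots is, up to sign, the lowest nonzero coefficient, an integer.\<close>
lemma monic_int_poly_root_lower_bound:
  fixes p :: "int poly" and w :: complex
  assumes monic: "Polynomial.lead_coeff p = 1"
    and w: "poly (of_int_poly p) w = 0" "w \<noteq> 0"
    and B: "1 \<le> B" "\<And>z :: complex. poly (of_int_poly p) z = 0 \<Longrightarrow> cmod z \<le> B"
  shows "1 \<le> cmod w * B ^ Polynomial.degree p"
proof -
  have p0: "p \<noteq> 0" using monic by auto
  have "\<exists>q. p = [:- 0, 1:] ^ Polynomial.order 0 p * q \<and> \<not> [:- 0, 1:] dvd q"
    using Polynomial.order_decomp[OF p0] by blast
  then obtain q where q: "p = [:0, 1:] ^ Polynomial.order 0 p * q" "\<not> [:0, 1:] dvd q" by auto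
  let ?k = "Polynomial.order 0 p"
  let ?q = "of_int_poly q :: complex poly"
  have q0: "Polynomial.coeff q 0 \<noteq> 0"
    using q(2) by (metis poly_0_coeff_0 poly_eq_0_iff_dvd minus_zero)
  then have qn0: "q \<noteq> 0" by auto
  have pq: "of_int_poly p = [:0, 1:] ^ ?k * ?q"
    by (subst q(1)) (simp add: hom_distribs)
  have lq: "Polynomial.lead_coeff q = 1"
    using monic arg_cong[OF q(1), of Polynomial.lead_coeff]
    by (simp add: Polynomial.lead_coeff_mult Polynomial.lead_coeff_power)
  have dq: "Polynomial.degree q \<le> Polynomial.degree p"
    by (subst q(1)) (use qn0 in \<open>simp add: Polynomial.degree_mult_eq\<close>)
  obtain as where as: "Polynomial.smult (Polynomial.lead_coeff ?q) (\<Prod>a\<leftarrow>as. [:- a, 1:]) = ?q"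
      "length as = Polynomial.degree ?q"
    using fundamental_theorem_algebra_factorized by blast
  have fq: "?q = (\<Prod>a\<leftarrow>as. [:- a, 1:])" using as(1) lq by simp
  have "poly ?q w = 0" using w pq by auto
  then have "(\<Prod>a\<leftarrow>as. w - a) = 0"
    by (simp add: fq poly_prod_list o_def)
  then have win: "w \<in> set as" by (auto simp: prod_list_zero_iff)
  have asB: "cmod a \<le> B" if "a \<in> set as" for a
  proof -
    have "poly ?q a = 0" using that
      by (auto simp add: fq poly_prod_list o_def prod_list_zero_iff)
    then show ?thesis using B(2)[of a] pq by auto
  qed
  have bound: "(\<Prod>a\<leftarrow>bs. cmod a) \<le> B ^ length bs" if "set bs \<subseteq> set as" for bs
    using that
  proof (induction bs)
    case (Cons b bs)
    have "cmod b * (\<Prod>a\<leftarrow>bs. cmod a) \<le> B * B ^ length bs"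
      using Cons asB B(1) by (intro mult_mono) (auto intro!: prod_list_nonneg)
    then show ?case by simp
  qed simp
  have "of_int (Polynomial.coeff q 0) = poly ?q 0" by (simp add: poly_0_coeff_0)
  also have "\<dots> = (\<Prod>a\<leftarrow>as. - a)" by (simp add: fq poly_prod_list o_def)
  finally have "cmod (of_int (Polynomial.coeff q 0)) = (\<Prod>a\<leftarrow>as. cmod a)"
  proof -
    have "cmod (\<Prod>a\<leftarrow>bs. - a) = (\<Prod>a\<leftarrow>bs. cmod a)" for bs
      by (induction bs) (auto simp: norm_mult)
    then show "of_int (Polynomial.coeff q 0) = (\<Prod>a\<leftarrow>as. - a) \<Longrightarrow> ?thesis" by simp
  qed
  moreover have "1 \<le> cmod (of_int (Polynomial.coeff q 0))"
    using q0 by (simp add: norm_of_int)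
  ultimately have "1 \<le> (\<Prod>a\<leftarrow>as. cmod a)" by simp
  also have "\<dots> = cmod w * (\<Prod>a\<leftarrow>remove1 w as. cmod a)"
    using win by (simp add: prod_list_map_remove1)
  also have "\<dots> \<le> cmod w * B ^ length (remove1 w as)"
    using bound[of "remove1 w as"] by (intro mult_left_mono) (auto dest: notin_set_remove1 simp: set_remove1_subset)
  also have "\<dots> \<le> cmod w * B ^ Polynomial.degree p"
    using B(1) as(2) dq by (intro mult_left_mono power_increasing) (auto simp: length_remove1)
  finally show ?thesis .
qed

text \<open>Read the eigenvector equation in a coordinate where the eigenvector has maximal modulus
  \<open>m\<close>; dividing by \<open>m\<close> leaves the row sum.\<close>

lemma eigenvalue_norm_le_row_sum:
  fixes A :: "complex mat"
  assumes A: "A \<in> carrier_mat n n" and ev: "eigenvalue A k"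
    and B: "\<And>i. i < n \<Longrightarrow> (\<Sum>j<n. cmod (A $$ (i, j))) \<le> B"
  shows "cmod k \<le> B"
proof -
  obtain v where v: "v \<in> carrier_vec n" "v \<noteq> 0\<^sub>v n" "A *\<^sub>v v = k \<cdot>\<^sub>v v"
    using ev A unfolding eigenvalue_def eigenvector_def by auto
  then obtain i0 where i0: "i0 < n" "v $ i0 \<noteq> 0" by (metis eq_vecI carrier_vecD index_zero_vec)
  define m where "m = Max ((\<lambda>i. cmod (v $ i)) ` {..<n})"
  have m: "cmod (v $ i) \<le> m" if "i < n" for i
    using that by (auto simp: m_def)
  have "m \<in> (\<lambda>i. cmod (v $ i)) ` {..<n}"
    unfolding m_def using i0 by (intro Max_in) auto
  then obtain i where i: "i < n" "m = cmod (v $ i)" by auto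
  have m0: "0 < m" using m[OF i0(1)] i0(2) by (meson zero_less_norm_iff less_le_trans)
  have "k * v $ i = (k \<cdot>\<^sub>v v) $ i" using v(1) i by simp
  also have "\<dots> = (A *\<^sub>v v) $ i" by (simp only: v(3))
  also have "\<dots> = (\<Sum>j<n. A $$ (i, j) * v $ j)"
    using v(1) A i by (auto simp: scalar_prod_def lessThan_atLeast0 intro!: sum.cong)
  finally have "cmod k * m = cmod (\<Sum>j<n. A $$ (i, j) * v $ j)"
    by (metis i(2) norm_mult)
  also have "\<dots> \<le> (\<Sum>j<n. cmod (A $$ (i, j)) * m)"
    using m by (intro sum_norm_le) (auto simp: norm_mult mult_left_mono)
  also have "\<dots> \<le> B * m"
    using B[OF i(1)] m0 by (simp flip: sum_distrib_right)
  finally show ?thesis using m0 by simp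
qed

text \<open>An integer matrix \<open>u\<close> with row sums at most \<open>B\<close> has
  \<open>v\<close> as an eigenvector with eigenvalue \<open>w\<close>, provided \<open>v\<close> is
  not zero. The entries of \<open>v\<close> may be dependent, so \<open>u\<close> is any such matrix
  and no field degree enters. The row sum norm is submultiplicative, so the bounds add and multiply
  along with the eigenvalues.\<close>

definition int_acts :: "'i set \<Rightarrow> ('i \<Rightarrow> complex) \<Rightarrow> real \<Rightarrow> complex \<Rightarrow> bool" where
  "int_acts I v B w \<longleftrightarrow> (\<exists>u :: 'i \<Rightarrow> 'i \<Rightarrow> int.
     \<forall>i\<in>I. w * v i = (\<Sum>j\<in>I. of_int (u i j) * v j) \<and> (\<Sum>j\<in>I. real_of_int \<bar>u i j\<bar>) \<le> B)"

lemma int_acts_mono: "int_acts I v B w \<Longrightarrow> B \<le> B' \<Longrightarrow> int_acts I v B' w"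
  unfolding int_acts_def by (meson order_trans)

lemma int_acts_of_int:
  assumes "finite I" shows "int_acts I v \<bar>of_int c\<bar> (of_int c)"
  unfolding int_acts_def
  by (rule exI[of _ "\<lambda>i j. if j = i then c else 0"])
    (use assms in \<open>auto simp: if_distrib if_distribR cong: if_cong\<close>)

lemma int_acts_add:
  assumes "int_acts I v B w" "int_acts I v B' w'"
  shows "int_acts I v (B + B') (w + w')"
proof -
  obtain u u' :: "'a \<Rightarrow> 'a \<Rightarrow> int" where
    u: "\<And>i. i \<in> I \<Longrightarrow> w * v i = (\<Sum>j\<in>I. of_int (u i j) * v j) \<and> (\<Sum>j\<in>I. real_of_int \<bar>u i j\<bar>) \<le> B" and
    u': "\<And>i. i \<in> I \<Longrightarrow> w' * v i = (\<Sum>j\<in>I. of_int (u' i j) * v j) \<and> (\<Sum>j\<in>I. real_of_int \<bar>u' i j\<bar>) \<le> B'"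
    using assms unfolding int_acts_def by blast
  have "(w + w') * v i = (\<Sum>j\<in>I. of_int (u i j + u' i j) * v j) \<and>
        (\<Sum>j\<in>I. real_of_int \<bar>u i j + u' i j\<bar>) \<le> B + B'" if "i \<in> I" for i
  proof
    show "(w + w') * v i = (\<Sum>j\<in>I. of_int (u i j + u' i j) * v j)"
      using u[OF that] u'[OF that] by (simp add: ring_distribs sum.distrib)
    have "(\<Sum>j\<in>I. real_of_int \<bar>u i j + u' i j\<bar>) \<le> (\<Sum>j\<in>I. real_of_int \<bar>u i j\<bar> + real_of_int \<bar>u' i j\<bar>)"
      by (intro sum_mono) linarith
    then show "(\<Sum>j\<in>I. real_of_int \<bar>u i j + u' i j\<bar>) \<le> B + B'"
      using u[OF that] u'[OF that] by (simp add: sum.distrib)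
  qed
  then show ?thesis unfolding int_acts_def by (intro exI[of _ "\<lambda>i j. u i j + u' i j"]) blast
qed

lemma int_acts_mult:
  assumes "finite I" "int_acts I v B w" "int_acts I v B' w'" "0 \<le> B'"
  shows "int_acts I v (B * B') (w * w')"
proof -
  obtain u u' :: "'a \<Rightarrow> 'a \<Rightarrow> int" where
    u: "\<And>i. i \<in> I \<Longrightarrow> w * v i = (\<Sum>j\<in>I. of_int (u i j) * v j) \<and> (\<Sum>j\<in>I. real_of_int \<bar>u i j\<bar>) \<le> B" and
    u': "\<And>i. i \<in> I \<Longrightarrow> w' * v i = (\<Sum>j\<in>I. of_int (u' i j) * v j) \<and> (\<Sum>j\<in>I. real_of_int \<bar>u' i j\<bar>) \<le> B'"
    using assms unfolding int_acts_def by blast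
  define t where "t i j = (\<Sum>k\<in>I. u i k * u' k j)" for i j
  have "w * w' * v i = (\<Sum>j\<in>I. of_int (t i j) * v j) \<and>
        (\<Sum>j\<in>I. real_of_int \<bar>t i j\<bar>) \<le> B * B'" if "i \<in> I" for i
  proof
    have "w * w' * v i = w' * (w * v i)" by simp
    also have "\<dots> = (\<Sum>k\<in>I. of_int (u i k) * (w' * v k))"
      using u[OF that] by (simp add: sum_distrib_left mult_ac)
    also have "\<dots> = (\<Sum>k\<in>I. \<Sum>j\<in>I. of_int (u i k * u' k j) * v j)"
      using u' by (intro sum.cong) (auto simp: sum_distrib_left mult_ac)
    also have "\<dots> = (\<Sum>j\<in>I. of_int (t i j) * v j)"
      by (subst sum.swap) (simp add: t_def sum_distrib_right)
    finally show "w * w' * v i = (\<Sum>j\<in>I. of_int (t i j) * v j)" .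
    have "(\<Sum>j\<in>I. real_of_int \<bar>t i j\<bar>) \<le> (\<Sum>j\<in>I. \<Sum>k\<in>I. real_of_int \<bar>u i k\<bar> * real_of_int \<bar>u' k j\<bar>)"
    proof (rule sum_mono)
      fix j
      have "\<bar>t i j\<bar> \<le> (\<Sum>k\<in>I. \<bar>u i k\<bar> * \<bar>u' k j\<bar>)"
        unfolding t_def by (rule order_trans[OF sum_abs]) (simp add: abs_mult)
      then have "real_of_int \<bar>t i j\<bar> \<le> of_int (\<Sum>k\<in>I. \<bar>u i k\<bar> * \<bar>u' k j\<bar>)"
        by (rule of_int_le_iff[THEN iffD2])
      then show "real_of_int \<bar>t i j\<bar> \<le> (\<Sum>k\<in>I. real_of_int \<bar>u i k\<bar> * real_of_int \<bar>u' k j\<bar>)"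
        by simp
    qed
    also have "\<dots> = (\<Sum>k\<in>I. real_of_int \<bar>u i k\<bar> * (\<Sum>j\<in>I. real_of_int \<bar>u' k j\<bar>))"
      by (subst sum.swap) (simp add: sum_distrib_left)
    also have "\<dots> \<le> (\<Sum>k\<in>I. real_of_int \<bar>u i k\<bar> * B')"
      using u' by (intro sum_mono mult_left_mono) auto
    also have "\<dots> \<le> B * B'"
      using u[OF that] assms(4) by (auto simp flip: sum_distrib_right intro: mult_right_mono)
    finally show "(\<Sum>j\<in>I. real_of_int \<bar>t i j\<bar>) \<le> B * B'" .
  qed
  then show ?thesis unfolding int_acts_def by blast
qed

lemma int_acts_power:
  assumes "finite I" "int_acts I v B w" "0 \<le> B"
  shows "int_acts I v (B ^ n) (w ^ n)"
proof (induction n)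
  case 0
  show ?case using int_acts_of_int[OF assms(1), of v 1] by simp
next
  case (Suc n)
  show ?case using int_acts_mult[OF assms(1,2) Suc] assms(3) by simp
qed

lemma int_acts_sum:
  assumes "finite I" "finite J" "\<And>j. j \<in> J \<Longrightarrow> int_acts I v (B j) (w j)"
  shows "int_acts I v (\<Sum>j\<in>J. B j) (\<Sum>j\<in>J. w j)"
  using assms(2,3)
proof (induction J rule: finite_induct)
  case empty
  show ?case using int_acts_of_int[OF assms(1), of v 0] by simp
next
  case (insert a J)
  then show ?case by (auto intro!: int_acts_add)
qed

text \<open>The number \<open>w\<close> is a root of the characteristic polynomial of an integer
  matrix. This polynomial is monic of degree \<open>card I\<close>, and the row sums bound all its
  roots by \<open>B\<close>, so the estimate for nonzero roots of monic integer polynomials applies.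
  The nonzero entry of \<open>v\<close> makes it a genuine eigenvector.\<close>

lemma int_acts_lower_bound:
  assumes I: "finite I" and act: "int_acts I v B w" and B: "1 \<le> B" and w: "w \<noteq> 0"
    and v: "i0 \<in> I" "v i0 \<noteq> 0"
  shows "1 \<le> cmod w * B ^ card I"
proof -
  obtain u :: "'a \<Rightarrow> 'a \<Rightarrow> int" where
    u: "\<And>i. i \<in> I \<Longrightarrow> w * v i = (\<Sum>j\<in>I. of_int (u i j) * v j)"
       "\<And>i. i \<in> I \<Longrightarrow> (\<Sum>j\<in>I. real_of_int \<bar>u i j\<bar>) \<le> B"
    using act unfolding int_acts_def by blast
  define n where "n = card I"
  obtain e where e: "bij_betw e {..<n} I"
    using ex_bij_betw_nat_finite[OF I] by (auto simp: n_def lessThan_atLeast0)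
  have eI: "e i \<in> I" if "i < n" for i using e that by (auto dest: bij_betwE)
  define M where "M = mat n n (\<lambda>(i, j). u (e i) (e j))"
  define A where "A = map_mat complex_of_int M"
  have M: "M \<in> carrier_mat n n" and A: "A \<in> carrier_mat n n" by (auto simp: M_def A_def)
  have cA: "char_poly A = of_int_poly (char_poly M)"
    unfolding A_def by (rule of_int_hom.char_poly_hom[OF M])
  define x where "x = vec n (\<lambda>i. v (e i))"
  have "eigenvector A x w"
    unfolding eigenvector_def
  proof (intro conjI)
    show "x \<in> carrier_vec (dim_row A)" using A by (simp add: x_def)
    obtain k where "k < n" "e k = i0" using e v(1) by (metis bij_betw_iff_bijections lessThan_iff)
    then show "x \<noteq> 0\<^sub>v (dim_row A)" using A v(2) by (metis carrier_matD(1) index_vec index_zero_vec(1) x_def)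
    show "A *\<^sub>v x = w \<cdot>\<^sub>v x"
    proof (rule eq_vecI)
      fix i assume "i < dim_vec (w \<cdot>\<^sub>v x)"
      then have i: "i < n" by (simp add: x_def)
      have "(A *\<^sub>v x) $ i = (\<Sum>j<n. of_int (u (e i) (e j)) * v (e j))"
        using i by (auto simp: A_def M_def x_def scalar_prod_def lessThan_atLeast0 intro!: sum.cong)
      also have "\<dots> = (\<Sum>j\<in>I. of_int (u (e i) j) * v j)"
        using sum.reindex_bij_betw[OF e, of "\<lambda>j. of_int (u (e i) j) * v j"] by simp
      also have "\<dots> = w * v (e i)" using u(1)[OF eI[OF i]] by simp
      finally show "(A *\<^sub>v x) $ i = (w \<cdot>\<^sub>v x) $ i" using i by (simp add: x_def)
    qed (use A in \<open>simp add: x_def\<close>)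
  qed
  then have "eigenvalue A w" unfolding eigenvalue_def by blast
  then have root: "poly (of_int_poly (char_poly M)) w = 0"
    using eigenvalue_root_char_poly[OF A] cA by simp
  have roots: "cmod z \<le> B" if "poly (of_int_poly (char_poly M)) z = 0" for z
  proof (rule eigenvalue_norm_le_row_sum[OF A])
    show "eigenvalue A z" using that eigenvalue_root_char_poly[OF A] cA by simp
    fix i assume i: "i < n"
    have "(\<Sum>j<n. cmod (A $$ (i, j))) = (\<Sum>j<n. real_of_int \<bar>u (e i) (e j)\<bar>)"
      using i by (auto simp: A_def M_def intro!: sum.cong)
    also have "\<dots> = (\<Sum>j\<in>I. real_of_int \<bar>u (e i) j\<bar>)"
      using sum.reindex_bij_betw[OF e, of "\<lambda>j. real_of_int \<bar>u (e i) j\<bar>"] by simp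
    also have "\<dots> \<le> B" using u(2)[OF eI[OF i]] .
    finally show "(\<Sum>j<n. cmod (A $$ (i, j))) \<le> B" .
  qed
  have "Polynomial.degree (char_poly M) = n" "Polynomial.lead_coeff (char_poly M) = 1"
    using degree_monic_char_poly[OF M] by auto
  then show ?thesis
    using monic_int_poly_root_lower_bound[OF _ root w B roots] by (simp add: n_def)
qed

section \<open>Values of integer polynomials at two algebraic numbers\<close>

definition bival :: "nat \<Rightarrow> (nat \<Rightarrow> nat \<Rightarrow> int) \<Rightarrow> complex \<Rightarrow> complex \<Rightarrow> complex" where
  "bival T c x y = (\<Sum>i\<le>T. \<Sum>j\<le>T. of_int (c i j) * x ^ i * y ^ j)"

text \<open>Size is measured by the length of some annihilating integer polynomial instead of the
  height. Any nonzero polynomial will do, so minimality is not carried along and the notion is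
  monotone in \<open>d\<close> and \<open>h\<close>.\<close>

definition int_algebraic :: "nat \<Rightarrow> real \<Rightarrow> complex \<Rightarrow> bool" where
  "int_algebraic d h x \<longleftrightarrow> (\<exists>p :: int poly. p \<noteq> 0 \<and> Polynomial.degree p \<le> d \<and>
     (\<Sum>i\<le>Polynomial.degree p. real_of_int \<bar>Polynomial.coeff p i\<bar>) \<le> h \<and> poly (of_int_poly p) x = 0)"

lemma int_algebraicE:
  assumes "int_algebraic d h x"
  obtains k p a where "1 \<le> k" "k \<le> d" "(a::int) \<noteq> 0" "real_of_int \<bar>a\<bar> \<le> h" "1 \<le> h"
    "(\<Sum>i<k. real_of_int \<bar>p i\<bar>) \<le> h" "of_int a * x ^ k = (\<Sum>i<k. of_int (p i) * x ^ i)"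
proof -
  obtain p :: "int poly" where p: "p \<noteq> 0" "Polynomial.degree p \<le> d"
    "(\<Sum>i\<le>Polynomial.degree p. real_of_int \<bar>Polynomial.coeff p i\<bar>) \<le> h" "poly (of_int_poly p) x = 0"
    using assms unfolding int_algebraic_def by blast
  define k where "k = Polynomial.degree p"
  let ?a = "Polynomial.lead_coeff p"
  have "(\<Sum>i<k. of_int (Polynomial.coeff p i) * x ^ i) + of_int ?a * x ^ k = 0"
    using p(4) by (simp add: poly_altdef k_def lessThan_Suc_atMost[symmetric])
  then have "of_int ?a * x ^ k = - (\<Sum>i<k. of_int (Polynomial.coeff p i) * x ^ i)"
    by (simp add: eq_neg_iff_add_eq_0 add.commute)
  then have eq: "of_int ?a * x ^ k = (\<Sum>i<k. of_int (- Polynomial.coeff p i) * x ^ i)"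
    by (simp add: sum_negf)
  have sum: "(\<Sum>i<k. real_of_int \<bar>Polynomial.coeff p i\<bar>) + real_of_int \<bar>?a\<bar> \<le> h"
    using p(3) by (simp add: k_def lessThan_Suc_atMost[symmetric])
  have nonneg: "0 \<le> (\<Sum>i<k. real_of_int \<bar>Polynomial.coeff p i\<bar>)" by (intro sum_nonneg) simp
  have lc: "?a \<noteq> 0" using p(1) by simp
  then have lc1: "1 \<le> real_of_int \<bar>?a\<bar>" by linarith
  \<comment> \<open>A nonzero constant has no root.\<close>
  have "k \<noteq> 0" using eq lc by (intro notI) simp
  then have "1 \<le> k" by simp
  moreover have "k \<le> d" using p(2) by (simp add: k_def)
  moreover note lc
  moreover have "real_of_int \<bar>?a\<bar> \<le> h" "1 \<le> h" using sum nonneg lc1 by linarith+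
  moreover have "(\<Sum>i<k. real_of_int \<bar>- Polynomial.coeff p i\<bar>) \<le> h"
    using sum lc1 by (simp only: abs_minus_cancel)
  ultimately show ?thesis using eq by (rule that)
qed

text \<open>Cauchy's bound: a nonzero integer leading coefficient has modulus at least 1, so for
  \<open>cmod x > 1\<close> the relation gives
  \<open>cmod x ^ k \<le> h * cmod x ^ (k - 1)\<close>.\<close>

lemma int_algebraic_norm_le:
  assumes "int_algebraic d h x" shows "cmod x \<le> h"
proof -
  obtain k p a where *: "1 \<le> k" "k \<le> d" "(a::int) \<noteq> 0" "real_of_int \<bar>a\<bar> \<le> h" "1 \<le> h"
    "(\<Sum>i<k. real_of_int \<bar>p i\<bar>) \<le> h" "of_int a * x ^ k = (\<Sum>i<k. of_int (p i) * x ^ i)"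
    by (rule int_algebraicE[OF assms])
  show ?thesis
  proof (cases "cmod x \<le> 1")
    case False
    then have x1: "1 < cmod x" by simp
    have "1 \<le> real_of_int \<bar>a\<bar>" using *(3) by linarith
    then have "cmod x ^ k \<le> \<bar>of_int a\<bar> * cmod x ^ k" by (simp add: mult_le_cancel_right1)
    also have "\<dots> = cmod (\<Sum>i<k. of_int (p i) * x ^ i)"
      by (simp flip: *(7) add: norm_mult norm_power)
    also have "\<dots> \<le> (\<Sum>i<k. real_of_int \<bar>p i\<bar> * cmod x ^ (k - 1))"
      using x1 by (intro sum_norm_le) (auto simp: norm_mult norm_power intro!: mult_left_mono power_increasing)
    also have "\<dots> \<le> h * cmod x ^ (k - 1)"
      using *(6) by (simp flip: sum_distrib_right add: mult_right_mono)
    finally have "cmod x * cmod x ^ (k - 1) \<le> h * cmod x ^ (k - 1)"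
      using *(1) by (simp flip: power_Suc)
    moreover have "0 < cmod x ^ (k - 1)" using x1 by (intro zero_less_power) linarith
    ultimately show ?thesis using mult_right_le_imp_le by blast
  qed (use *(5) in simp)
qed

text \<open>The matrix of \<open>of_int a * x\<close> is a companion matrix with the denominator
  cleared: every row but the last shifts to the next power with weight \<open>a\<close>, and the
  last row is the given relation. Nothing is divided by \<open>a\<close>, hence integrality.\<close>

lemma int_acts_powers:
  assumes k: "1 \<le> k" and h: "real_of_int \<bar>a\<bar> \<le> h" "(\<Sum>i<k. real_of_int \<bar>p i\<bar>) \<le> h"
    and x: "of_int a * x ^ k = (\<Sum>i<k. of_int (p i) * x ^ i)"
  shows "int_acts {..<k} (\<lambda>i. x ^ i) h (of_int a * x)"
  unfolding int_acts_def
proof (intro exI ballI conjI)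
  let ?u = "\<lambda>i j. if Suc i < k then (if j = Suc i then a else 0) else p j"
  fix i assume i: "i \<in> {..<k}"
  show "of_int a * x * x ^ i = (\<Sum>j<k. of_int (?u i j) * x ^ j)"
  proof (cases "Suc i < k")
    case True
    then show ?thesis by (simp add: if_distrib if_distribR cong: if_cong)
  next
    case False
    then have "k = Suc i" using i by simp
    then show ?thesis using x by (simp add: mult.assoc)
  qed
  show "(\<Sum>j<k. real_of_int \<bar>?u i j\<bar>) \<le> h"
  proof (cases "Suc i < k")
    case True
    then show ?thesis using h(1) by (simp add: if_distrib if_distribR cong: if_cong)
  qed (use h(2) in simp)
qed

text \<open>Kronecker product of the matrix with the identity on the second index, which leaves the
  row sums unchanged. \<open>int_acts_tensor2\<close> is the mirror image.\<close>

lemma int_acts_tensor1: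
  assumes "finite I" "finite J" "int_acts I v B w"
  shows "int_acts (I \<times> J) (\<lambda>(i, j). v i * v' j) B w"
proof -
  obtain u :: "'a \<Rightarrow> 'a \<Rightarrow> int" where
    u: "\<And>i. i \<in> I \<Longrightarrow> w * v i = (\<Sum>j\<in>I. of_int (u i j) * v j) \<and> (\<Sum>j\<in>I. real_of_int \<bar>u i j\<bar>) \<le> B"
    using assms(3) unfolding int_acts_def by blast
  let ?u = "\<lambda>(i, j) (i', j'). if j' = j then u i i' else 0"
  have "w * (v i * v' j) = (\<Sum>(i', j')\<in>I \<times> J. of_int (?u (i, j) (i', j')) * (v i' * v' j')) \<and>
     (\<Sum>(i', j')\<in>I \<times> J. real_of_int \<bar>?u (i, j) (i', j')\<bar>) \<le> B" if "i \<in> I" "j \<in> J" for i j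
  proof -
    have "w * (v i * v' j) = (w * v i) * v' j" by simp
    also have "\<dots> = (\<Sum>i'\<in>I. of_int (u i i') * v i' * v' j)"
      using u[OF that(1)] by (simp add: sum_distrib_right)
    finally show ?thesis using that u[OF that(1)] assms(2)
      by (auto simp flip: sum.cartesian_product simp: if_distrib if_distribR mult.assoc cong: if_cong)
  qed
  then show ?thesis
    unfolding int_acts_def by (intro exI[of _ ?u]) (auto simp: case_prod_unfold cong: if_cong)
qed

lemma sum_Times_fst_eq:
  assumes "finite I" "i \<in> I"
  shows "(\<Sum>p\<in>I \<times> J. if fst p = i then g (snd p) else 0) = (\<Sum>j\<in>J. g j)"
proof -
  have "(\<Sum>i'\<in>I. \<Sum>j\<in>J. if i' = i then g j else 0) =
        (\<Sum>p\<in>I \<times> J. if fst p = i then g (snd p) else 0)"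
    by (simp add: sum.cartesian_product case_prod_unfold)
  moreover have "(\<Sum>i'\<in>I. \<Sum>j\<in>J. if i' = i then g j else 0) =
        (\<Sum>i'\<in>I. if i' = i then (\<Sum>j\<in>J. g j) else 0)"
    by (intro sum.cong) auto
  ultimately show ?thesis using assms by simp
qed

lemma int_acts_tensor2:
  assumes "finite I" "finite J" "int_acts J v' B w"
  shows "int_acts (I \<times> J) (\<lambda>(i, j). v i * v' j) B w"
proof -
  obtain u :: "'b \<Rightarrow> 'b \<Rightarrow> int" where
    u: "\<And>i. i \<in> J \<Longrightarrow> w * v' i = (\<Sum>j\<in>J. of_int (u i j) * v' j) \<and> (\<Sum>j\<in>J. real_of_int \<bar>u i j\<bar>) \<le> B"
    using assms(3) unfolding int_acts_def by blast
  let ?u = "\<lambda>(i, j) (i', j'). if i' = i then u j j' else 0"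
  have "w * (v i * v' j) = (\<Sum>(i', j')\<in>I \<times> J. of_int (?u (i, j) (i', j')) * (v i' * v' j')) \<and>
     (\<Sum>(i', j')\<in>I \<times> J. real_of_int \<bar>?u (i, j) (i', j')\<bar>) \<le> B" if "i \<in> I" "j \<in> J" for i j
  proof -
    have "w * (v i * v' j) = v i * (w * v' j)" by simp
    also have "\<dots> = (\<Sum>j'\<in>J. of_int (u j j') * (v i * v' j'))"
      using u[OF that(2)] by (simp add: sum_distrib_left mult_ac)
    finally have "w * (v i * v' j) = (\<Sum>j'\<in>J. of_int (u j j') * (v i * v' j'))" .
    then show ?thesis using u[OF that(2)] that(1) assms(1)
      by (simp add: sum_Times_fst_eq[where g = "\<lambda>j'. of_int (u j j') * (v i * v' j')"]
          sum_Times_fst_eq[where g = "\<lambda>j'. \<bar>real_of_int (u j j')\<bar>"]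
          case_prod_unfold if_distrib if_distribR cong: if_cong)
  qed
  then show ?thesis
    unfolding int_acts_def by (intro exI[of _ ?u]) (auto simp: case_prod_unfold cong: if_cong)
qed

text \<open>The factor \<open>a ^ T * b ^ T\<close> is distributed over each monomial as
  \<open>a ^ (T - i) * (a * x) ^ i\<close> and likewise for \<open>y\<close>, so that every term is
  built from numbers acting by integer matrices of norm at most \<open>h\<close>. Summing the
  \<open>(T + 1)\<^sup>2\<close> terms gives one matrix, indexed by at most \<open>d\<^sup>2\<close>
  monomials, with row sums at most \<open>B\<close>.\<close>

lemma bival_lower_bound:
  assumes x: "int_algebraic d h x" and y: "int_algebraic d h y"
    and c: "\<And>i j. i \<le> T \<Longrightarrow> j \<le> T \<Longrightarrow> real_of_int \<bar>c i j\<bar> \<le> L" and L: "1 \<le> L"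
    and nz: "bival T c x y \<noteq> 0"
  shows "1 \<le> cmod (bival T c x y) * (real (T + 1) ^ 2 * L * h ^ (2 * T)) ^ (d\<^sup>2 + 1)"
proof -
  obtain k p a where p: "1 \<le> k" "k \<le> d" "(a::int) \<noteq> 0" "real_of_int \<bar>a\<bar> \<le> h" "1 \<le> h"
    "(\<Sum>i<k. real_of_int \<bar>p i\<bar>) \<le> h" "of_int a * x ^ k = (\<Sum>i<k. of_int (p i) * x ^ i)"
    by (rule int_algebraicE[OF x])
  obtain l q b where q: "1 \<le> l" "l \<le> d" "(b::int) \<noteq> 0" "real_of_int \<bar>b\<bar> \<le> h" "1 \<le> h"
    "(\<Sum>i<l. real_of_int \<bar>q i\<bar>) \<le> h" "of_int b * y ^ l = (\<Sum>i<l. of_int (q i) * y ^ i)"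
    by (rule int_algebraicE[OF y])
  define B where "B = real (T + 1) ^ 2 * L * h ^ (2 * T)"
  define I where "I = {..<k} \<times> {..<l}"
  define v where "v = (\<lambda>(i, j). x ^ i * y ^ j)"
  have I: "finite I" by (simp add: I_def)
  have h0: "0 \<le> h" using p(5) by simp
  have actx: "int_acts I v h (of_int a * x)"
    unfolding I_def v_def by (intro int_acts_tensor1 int_acts_powers[OF p(1,4,6,7)]) auto
  have acty: "int_acts I v h (of_int b * y)"
    unfolding I_def v_def by (intro int_acts_tensor2 int_acts_powers[OF q(1,4,6,7)]) auto
  have acta: "int_acts I v h (of_int a)"
    using int_acts_mono[OF int_acts_of_int[OF I]] p(4) by (simp add: int_acts_mono)
  have actb: "int_acts I v h (of_int b)"
    using int_acts_mono[OF int_acts_of_int[OF I]] q(4) by (simp add: int_acts_mono)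
  define w where "w = of_int a ^ T * of_int b ^ T * bival T c x y"
  have monomial: "int_acts I v (L * h ^ (2 * T)) (of_int a ^ T * of_int b ^ T * (of_int (c i j) * x ^ i * y ^ j))"
    if ij: "i \<le> T" "j \<le> T" for i j
  proof -
    have "int_acts I v (L * (h ^ (T - i) * h ^ i * (h ^ (T - j) * h ^ j)))
       (of_int (c i j) * (of_int a ^ (T - i) * (of_int a * x) ^ i * (of_int b ^ (T - j) * (of_int b * y) ^ j)))"
      using h0 int_acts_mono[OF int_acts_of_int[OF I]] c[OF ij]
      by (intro int_acts_mult[OF I] int_acts_power[OF I] acta actb actx acty) auto
    moreover have "h ^ (T - i) * h ^ i * (h ^ (T - j) * h ^ j) = h ^ (2 * T)"
      using ij by (simp only: power_add[symmetric] le_add_diff_inverse2 mult_2)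
    moreover have "of_int a ^ T = of_int a ^ (T - i) * (of_int a ^ i :: complex)"
                  "of_int b ^ T = of_int b ^ (T - j) * (of_int b ^ j :: complex)"
      using ij by (simp_all only: power_add[symmetric] le_add_diff_inverse2)
    then have "of_int a ^ T * of_int b ^ T * (of_int (c i j) * x ^ i * y ^ j) =
      of_int (c i j) * (of_int a ^ (T - i) * (of_int a * x) ^ i * (of_int b ^ (T - j) * (of_int b * y) ^ j))"
      by (simp only: power_mult_distrib mult_ac)
    ultimately show ?thesis by (simp only:)
  qed
  have "w = (\<Sum>i\<le>T. \<Sum>j\<le>T. of_int a ^ T * of_int b ^ T * (of_int (c i j) * x ^ i * y ^ j))"
    by (simp add: w_def bival_def sum_distrib_left)
  moreover have "int_acts I v (\<Sum>i\<le>T. \<Sum>j\<le>T. L * h ^ (2 * T))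
     (\<Sum>i\<le>T. \<Sum>j\<le>T. of_int a ^ T * of_int b ^ T * (of_int (c i j) * x ^ i * y ^ j))"
    by (intro int_acts_sum[OF I] monomial) auto
  moreover have "(\<Sum>i\<le>T. \<Sum>j\<le>T. L * h ^ (2 * T)) = B"
    by (simp add: B_def power2_eq_square algebra_simps)
  ultimately have act: "int_acts I v B w" by simp
  have h2: "1 \<le> h ^ (2 * T)" using p(5) by (rule one_le_power)
  have TL: "1 \<le> real (T + 1) ^ 2 * L"
    using mult_mono[of 1 "real (T + 1) ^ 2" 1 L] L by simp
  then have B1: "1 \<le> B" and hB: "h ^ (2 * T) \<le> B"
    using mult_mono[of 1 "real (T + 1) ^ 2 * L" "h ^ (2 * T)" "h ^ (2 * T)"] h2
    unfolding B_def by linarith+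
  have "w \<noteq> 0" using nz p(3) q(3) by (simp add: w_def)
  \<comment> \<open>The entry with index \<open>(0, 0)\<close> is the monomial 1, hence
    nonzero.\<close>
  then have "1 \<le> cmod w * B ^ card I"
    by (rule int_acts_lower_bound[OF I act B1, where ?i0.0 = "(0, 0)"]) (use p(1) q(1) in \<open>auto simp: I_def v_def\<close>)
  also have "\<dots> \<le> (h ^ (2 * T) * cmod (bival T c x y)) * B ^ (d\<^sup>2)"
  proof (rule mult_mono)
    have "\<bar>real_of_int a\<bar> ^ T * \<bar>real_of_int b\<bar> ^ T \<le> h ^ T * h ^ T"
      using p(4) q(4) h0 by (intro mult_mono power_mono) auto
    then have "\<bar>real_of_int a\<bar> ^ T * \<bar>real_of_int b\<bar> ^ T \<le> h ^ (2 * T)"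
      by (simp add: mult_2 power_add)
    then show "cmod w \<le> h ^ (2 * T) * cmod (bival T c x y)"
      by (simp add: w_def norm_mult norm_power mult_right_mono)
    have "card I \<le> d\<^sup>2" using p(2) q(2) by (simp add: I_def power2_eq_square mult_le_mono)
    then show "B ^ card I \<le> B ^ d\<^sup>2" using B1 by (rule power_increasing)
  qed (use B1 h0 in auto)
  \<comment> \<open>The cleared denominator costs at most one further factor \<open>B\<close>: this
    is the \<open>+ 1\<close> in the exponent.\<close>
  also have "\<dots> \<le> (B * cmod (bival T c x y)) * B ^ (d\<^sup>2)"
    using hB B1 by (intro mult_right_mono) auto
  also have "\<dots> = cmod (bival T c x y) * B ^ (d\<^sup>2 + 1)"
    by (simp only: power_add power_one_right mult_ac)
  finally show ?thesis unfolding B_def .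
qed

lemma bival_norm_le:
  assumes "\<And>i j. i \<le> T \<Longrightarrow> j \<le> T \<Longrightarrow> real_of_int \<bar>c i j\<bar> \<le> L"
    and "cmod x \<le> Rx" "cmod y \<le> Ry" "1 \<le> Rx" "1 \<le> Ry"
  shows "cmod (bival T c x y) \<le> real (T + 1) ^ 2 * L * (Rx ^ T * Ry ^ T)"
proof -
  have "cmod (bival T c x y) \<le> (\<Sum>i\<le>T. \<Sum>j\<le>T. L * (Rx ^ T * Ry ^ T))"
    unfolding bival_def
  proof (rule sum_norm_le, rule sum_norm_le)
    fix i j assume "i \<in> {..T}" "j \<in> {..T}"
    then have ij: "i \<le> T" "j \<le> T" by auto
    have "cmod x ^ i \<le> Rx ^ T"
      using power_mono[of "cmod x" Rx i] power_increasing[OF ij(1), of Rx] assms by simp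
    moreover have "cmod y ^ j \<le> Ry ^ T"
      using power_mono[of "cmod y" Ry j] power_increasing[OF ij(2), of Ry] assms by simp
    ultimately have "\<bar>of_int (c i j)\<bar> * (cmod x ^ i * cmod y ^ j) \<le> L * (Rx ^ T * Ry ^ T)"
      using assms(1)[OF ij] assms(4,5) by (intro mult_mono) auto
    then show "cmod (of_int (c i j) * x ^ i * y ^ j) \<le> L * (Rx ^ T * Ry ^ T)"
      by (simp add: norm_mult norm_power mult.assoc)
  qed
  also have "(\<Sum>i\<le>T. \<Sum>j\<le>T. L * (Rx ^ T * Ry ^ T)) = real (T + 1) ^ 2 * L * (Rx ^ T * Ry ^ T)"
    by (simp add: power2_eq_square algebra_simps)
  finally show ?thesis .
qed

section \<open>Polynomials vanishing at algebraic points\<close>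

text \<open>A Siegel lemma by counting. The arrays with entries in \<open>{0..int L}\<close>
  outnumber the cells into which the rounded values on \<open>Z\<close> fall, so two arrays have
  nearly equal values there. Their difference takes values on \<open>Z\<close> that are too small
  for \<open>bival_lower_bound\<close>, hence zero. Each point thus uses up
  \<open>4 * (d\<^sup>2 + 3)\<close> coefficients.\<close>

lemma exists_bival_vanishing:
  fixes x y :: "'a \<Rightarrow> complex" and h T d :: nat
  assumes Z: "finite Z" and alg: "\<And>z. z \<in> Z \<Longrightarrow> int_algebraic d h (x z)" "\<And>z. z \<in> Z \<Longrightarrow> int_algebraic d h (y z)"
    and h: "1 \<le> h" and T: "1 \<le> T" and N: "4 * card Z * (d\<^sup>2 + 3) \<le> (T + 1)\<^sup>2"
  defines "L \<equiv> (T + 1)\<^sup>2 * h ^ (2 * T)"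
  shows "\<exists>c. (\<forall>i\<le>T. \<forall>j\<le>T. \<bar>c i j\<bar> \<le> int L) \<and> (\<exists>i\<le>T. \<exists>j\<le>T. c i j \<noteq> 0) \<and>
             (\<forall>z\<in>Z. bival T c (x z) (y z) = 0)"
proof -
  define B where "B = real L ^ 2"
  have "4 \<le> (T + 1)\<^sup>2" using power_mono[of 2 "T + 1" 2] T by simp
  moreover have "1 \<le> h ^ (2 * T)" using h by simp
  ultimately have "4 * 1 \<le> L" unfolding L_def by (rule mult_le_mono)
  then have L4: "4 \<le> L" by simp
  have B16: "16 \<le> B" using power_mono[of 4 "real L" 2] L4 by (simp add: B_def)
  \<comment> \<open>\<open>L\<close> is chosen so that this product is exactly its square. The
    product is both the trivial bound for the values and the base in the lower bound.\<close>
  have BL: "real (T + 1) ^ 2 * real L * real h ^ (2 * T) = B"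
    by (simp add: B_def L_def power2_eq_square algebra_simps)
  define m where "m = 2 * L ^ (2 * (d\<^sup>2 + 2))"
  \<comment> \<open>The mesh is \<open>1 / K\<close>. Equal cells for real and imaginary parts give
    a difference of modulus below \<open>2 / K\<close>, which is
    \<open>1 / B ^ (d\<^sup>2 + 1)\<close>, the Liouville threshold.\<close>
  define K where "K = 2 * B ^ (d\<^sup>2 + 1)"
  have K0: "0 < K" using B16 by (simp add: K_def)
  have mK: "real m = K * B" by (simp add: m_def K_def B_def power_mult[symmetric] power_add[symmetric])
  \<comment> \<open>With nonnegative entries, the difference of two arrays still has entries of
    absolute value at most \<open>L\<close>.\<close>
  define F where "F = ({..T} \<times> {..T}) \<rightarrow>\<^sub>E {0..int L}"
  define G where "G = Z \<rightarrow>\<^sub>E ({- int m..int m} \<times> {- int m..int m})"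
  define P where "P = (\<lambda>c z. bival T (\<lambda>i j. c (i, j)) (x z) (y z))"
  define \<Phi> where "\<Phi> = (\<lambda>c. \<lambda>z\<in>Z. (\<lfloor>K * Re (P c z)\<rfloor>, \<lfloor>K * Im (P c z)\<rfloor>))"
  have cF: "\<bar>c (i, j)\<bar> \<le> int L" "0 \<le> c (i, j)" if "c \<in> F" "i \<le> T" "j \<le> T" for c i j
    using that by (auto simp: F_def PiE_iff Pi_iff)
  have PB: "cmod (P c z) \<le> B" if "c \<in> F" "z \<in> Z" for c z
  proof -
    have "real_of_int \<bar>c (i, j)\<bar> \<le> real L" if "i \<le> T" "j \<le> T" for i j
      using cF(1)[OF \<open>c \<in> F\<close> that] by linarith
    then have "cmod (P c z) \<le> real (T + 1) ^ 2 * real L * (real h ^ T * real h ^ T)"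
      unfolding P_def using h
      by (intro bival_norm_le int_algebraic_norm_le[OF alg(1)[OF that(2)]]
          int_algebraic_norm_le[OF alg(2)[OF that(2)]]) simp_all
    also have "real h ^ T * real h ^ T = real h ^ (2 * T)" by (simp only: mult_2 power_add)
    finally show ?thesis unfolding BL .
  qed
  have rng: "\<Phi> ` F \<subseteq> G"
  proof (rule image_subsetI)
    fix c assume c: "c \<in> F"
    have "\<lfloor>K * t\<rfloor> \<in> {- int m..int m}" if "\<bar>t\<bar> \<le> B" for t
    proof -
      have "\<bar>K * t\<bar> \<le> K * B" using that K0 by (simp add: abs_mult)
      then have "- real m \<le> K * t" "K * t \<le> real m" using mK by linarith+
      then show ?thesis by (simp add: le_floor_iff floor_le_iff)
    qed
    moreover have "\<bar>Re (P c z)\<bar> \<le> B" "\<bar>Im (P c z)\<bar> \<le> B" if "z \<in> Z" for z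
      using PB[OF c that] abs_Re_le_cmod[of "P c z"] abs_Im_le_cmod[of "P c z"] by linarith+
    ultimately show "\<Phi> c \<in> G" by (auto simp: \<Phi>_def G_def)
  qed
  have cardF: "card F = (L + 1) ^ ((T + 1)\<^sup>2)"
  proof -
    have "card {0..int L} = L + 1" by simp
    then show ?thesis by (simp only: F_def card_PiE finite_cartesian_product finite_atMost prod_constant
          card_cartesian_product card_atMost power2_eq_square Suc_eq_plus1)
  qed
  have cardG: "card G = (2 * m + 1) ^ (2 * card Z)"
  proof -
    have "card {- int m..int m} = 2 * m + 1" by simp
    then have "card ({- int m..int m} \<times> {- int m..int m}) = (2 * m + 1)\<^sup>2"
      by (simp only: card_cartesian_product power2_eq_square)
    then show ?thesis using Z by (simp only: G_def card_PiE prod_constant power_mult)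
  qed
  \<comment> \<open>The source of the term \<open>d\<^sup>2 + 3\<close> in the assumption
    \<open>N\<close>. Real and imaginary parts contribute another factor 2 in the exponent of
    \<open>card G\<close>.\<close>
  have "2 * m + 1 \<le> L ^ (2 * (d\<^sup>2 + 3))"
  proof -
    have "1 \<le> L ^ (2 * (d\<^sup>2 + 2))" using L4 by simp
    then have "2 * m + 1 \<le> 16 * L ^ (2 * (d\<^sup>2 + 2))" unfolding m_def by linarith
    also have "\<dots> \<le> L\<^sup>2 * L ^ (2 * (d\<^sup>2 + 2))"
      using power_mono[of 4 L 2] L4 by (intro mult_right_mono) auto
    also have "\<dots> = L ^ (2 * (d\<^sup>2 + 3))" 
    proof -
      have "2 + 2 * (d\<^sup>2 + 2) = 2 * (d\<^sup>2 + 3)" by simp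
      then show ?thesis by (simp only: power_add[symmetric])
    qed
    finally show ?thesis .
  qed
  then have "card G \<le> (L ^ (2 * (d\<^sup>2 + 3))) ^ (2 * card Z)"
    unfolding cardG by (intro power_mono) auto
  also have "\<dots> = L ^ (2 * (d\<^sup>2 + 3) * (2 * card Z))" by (simp only: power_mult)
  also have "2 * (d\<^sup>2 + 3) * (2 * card Z) = 4 * card Z * (d\<^sup>2 + 3)" by simp
  also have "L ^ (4 * card Z * (d\<^sup>2 + 3)) \<le> L ^ ((T + 1)\<^sup>2)" using N L4 by (intro power_increasing) auto
  also have "\<dots> < (L + 1) ^ ((T + 1)\<^sup>2)" by (intro power_strict_mono) auto
  finally have "card G < card F" using cardF by simp
  moreover have "finite G" unfolding G_def using Z by (intro finite_PiE) auto
  ultimately have "\<not> inj_on \<Phi> F"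
    using card_mono[OF \<open>finite G\<close> rng] card_image[of \<Phi> F] by auto
  then obtain c c' where c: "c \<in> F" "c' \<in> F" "c \<noteq> c'" "\<Phi> c = \<Phi> c'" unfolding inj_on_def by blast
  define e where "e = (\<lambda>i j. c (i, j) - c' (i, j))"
  have eL: "\<bar>e i j\<bar> \<le> int L" if "i \<le> T" "j \<le> T" for i j
    using cF[OF c(1) that] cF[OF c(2) that] by (simp add: e_def)
  have eP: "bival T e (x z) (y z) = P c z - P c' z" for z
    by (simp add: bival_def P_def e_def ring_distribs sum_subtractf)
  show ?thesis
  proof (intro exI[of _ e] conjI ballI)
    show "\<forall>i\<le>T. \<forall>j\<le>T. \<bar>e i j\<bar> \<le> int L" using eL by blast
    show "\<exists>i\<le>T. \<exists>j\<le>T. e i j \<noteq> 0"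
    proof (rule ccontr)
      assume "\<not> ?thesis"
      then have "c p = c' p" if "p \<in> {..T} \<times> {..T}" for p using that by (auto simp: e_def)
      then have "c = c'" using c(1,2) unfolding F_def by (intro PiE_ext) auto
      then show False using c(3) by simp
    qed
    fix z assume z: "z \<in> Z"
    have fl: "\<lfloor>K * Re (P c z)\<rfloor> = \<lfloor>K * Re (P c' z)\<rfloor>" "\<lfloor>K * Im (P c z)\<rfloor> = \<lfloor>K * Im (P c' z)\<rfloor>"
      using fun_cong[OF c(4), of z] z by (auto simp: \<Phi>_def)
    have "\<bar>K * Re (P c z) - K * Re (P c' z)\<bar> < 1" "\<bar>K * Im (P c z) - K * Im (P c' z)\<bar> < 1"
      using floor_eq_imp_diff_1[OF fl(1)] floor_eq_imp_diff_1[OF fl(2)] by blast+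
    moreover have "K * \<bar>Re (P c z) - Re (P c' z)\<bar> = \<bar>K * Re (P c z) - K * Re (P c' z)\<bar>"
      "K * \<bar>Im (P c z) - Im (P c' z)\<bar> = \<bar>K * Im (P c z) - K * Im (P c' z)\<bar>"
      using K0 by (simp_all only: abs_mult abs_of_pos right_diff_distrib[symmetric])
    ultimately have "K * \<bar>Re (P c z) - Re (P c' z)\<bar> + K * \<bar>Im (P c z) - Im (P c' z)\<bar> < 2"
      by linarith
    moreover have "K * cmod (P c z - P c' z) \<le> K * (\<bar>Re (P c z) - Re (P c' z)\<bar> + \<bar>Im (P c z) - Im (P c' z)\<bar>)"
      using cmod_le[of "P c z - P c' z"] K0 by (intro mult_left_mono) auto
    ultimately have "K * cmod (P c z - P c' z) < 2" by (simp only: distrib_left)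
    then have "cmod (bival T e (x z) (y z)) * B ^ (d\<^sup>2 + 1) < 1"
    proof -
      have "K * cmod (P c z - P c' z) = 2 * (cmod (bival T e (x z) (y z)) * B ^ (d\<^sup>2 + 1))"
        by (simp only: eP K_def mult_ac)
      then show "K * cmod (P c z - P c' z) < 2 \<Longrightarrow> ?thesis" by linarith
    qed
    moreover have "1 \<le> cmod (bival T e (x z) (y z)) * B ^ (d\<^sup>2 + 1)" if "bival T e (x z) (y z) \<noteq> 0"
    proof -
      have "real_of_int \<bar>e i j\<bar> \<le> real L" if "i \<le> T" "j \<le> T" for i j
        using eL[OF that] by linarith
      then show ?thesis
        by (rule bival_lower_bound[OF alg(1)[OF z] alg(2)[OF z] _ _ that, of "real L", unfolded BL])
          (use L4 in auto)
    qed
    ultimately show "bival T e (x z) (y z) = 0" by (meson linorder_not_less)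
  qed
qed

section \<open>Degrees and heights\<close>

lemma clear_denominators:
  assumes "finite S" "S \<subseteq> (\<rat> :: complex set)"
  shows "\<exists>D :: int. D \<noteq> 0 \<and> (\<forall>q\<in>S. of_int D * q \<in> \<int>)"
  using assms
proof (induction S rule: finite_induct)
  case empty
  show ?case by (intro exI[of _ 1]) simp
next
  case (insert q S)
  then obtain D :: int where D: "D \<noteq> 0" "\<forall>q\<in>S. of_int D * q \<in> \<int>" by auto
  from insert.prems obtain r where r: "q = of_rat r" by (auto elim: Rats_cases)
  obtain a b where ab: "quotient_of r = (a, b)" by force
  have b: "b > 0" using quotient_of_denom_pos[OF ab] .
  have "q = of_int a / of_int b"
    using quotient_of_div[OF ab] r by (simp add: of_rat_divide)
  then have q: "of_int b * q = of_int a" using b by simp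
  have "of_int (D * b) * t \<in> \<int>" if t: "t \<in> insert q S" for t
  proof (cases "t = q")
    case True
    have "of_int (D * b) * q = of_int D * (of_int b * q)" by simp
    also have "\<dots> = of_int (D * a)" by (simp add: q)
    finally show ?thesis using True Ints_of_int by metis
  next
    case False
    then have "of_int D * t \<in> \<int>" using t D(2) by auto
    then have "of_int b * (of_int D * t) \<in> \<int>" by (rule Ints_mult[OF Ints_of_int])
    moreover have "of_int (D * b) * t = of_int b * (of_int D * t)" by (simp add: mult_ac)
    ultimately show ?thesis by (simp only:)
  qed
  then show ?case using D(1) b by (intro exI[of _ "D * b"]) auto
qed

section \<open>Linear algebra over the rationals inside the complex field\<close>

lemma complex_ring_simps:
  "carrier complex_ring = UNIV" "\<zero>\<^bsub>complex_ring\<^esub> = 0" "\<one>\<^bsub>complex_ring\<^esub> = 1"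
  "a \<otimes>\<^bsub>complex_ring\<^esub> b = a * b" "a \<oplus>\<^bsub>complex_ring\<^esub> b = a + b"
  by (simp_all add: ring_of_type_algebra_def)

lemma combine_complex_ring:
  assumes "length Ks = length Us"
  shows "ring.combine complex_ring Ks Us = (\<Sum>i<length Us. Ks ! i * Us ! i)"
proof -
  interpret field complex_ring by (rule field_from_type_algebra)
  show ?thesis using assms
  proof (induction Ks Us rule: list_induct2)
    case Nil
    show ?case by (simp add: complex_ring_simps)
  next
    case (Cons k Ks u Us)
    then show ?case
      by (simp add: complex_ring_simps sum.lessThan_Suc_shift del: sum.lessThan_Suc)
  qed
qed

lemma subfield_Rats: "subfield (\<rat> :: complex set) complex_ring"
proof -
  interpret field complex_ring by (rule field_from_type_algebra)
  have inv: "inv\<^bsub>complex_ring\<^esub> k \<in> \<rat>" if "k \<in> \<rat> - {0}" for k :: complex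
  proof -
    have "inv\<^bsub>complex_ring\<^esub> k = inverse k"
      by (rule comm_inv_char) (use that in \<open>auto simp: complex_ring_simps\<close>)
    then show ?thesis using that by simp
  qed
  have neg: "\<ominus>\<^bsub>complex_ring\<^esub> k = - k" for k :: complex
    by (rule minus_equality) (auto simp: complex_ring_simps)
  show ?thesis
  proof (rule subfieldI')
    show "subring (\<rat> :: complex set) complex_ring"
      by (rule subringI) (auto simp: neg, auto simp: complex_ring_simps)
    show "inv\<^bsub>complex_ring\<^esub> k \<in> \<rat>" if "k \<in> \<rat> - {\<zero>\<^bsub>complex_ring\<^esub>}" for k :: complex
      using inv that by (simp add: complex_ring_simps)
  qed
qed

text \<open>The \<open>d + 1\<close> powers of \<open>x\<close> up to \<open>x ^ d\<close> lie in a
  rational vector space of dimension at most \<open>d\<close>, so they are dependent; clearing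
  denominators in the relation gives the polynomial.\<close>

lemma int_poly_root_of_degree_over_Q:
  assumes "degree_over_Q S \<le> enat d" "x \<in> S"
  shows "\<exists>p :: int poly. p \<noteq> 0 \<and> Polynomial.degree p \<le> d \<and> poly (of_int_poly p) x = 0"
proof -
  interpret field complex_ring by (rule field_from_type_algebra)
  let ?F = "generate_field complex_ring S"
  have fin: "finite_dimension \<rat> ?F" and dim: "dim \<rat> ?F \<le> d"
    using assms(1) by (auto simp: degree_over_Q_def split: if_splits)
  have dimF: "dimension (dim \<rat> ?F) \<rat> ?F"
    using finite_dimensionE[OF subfield_Rats fin] by (simp add: over_def)
  have one: "1 \<in> ?F" using generate_field.one[of complex_ring S] by (simp add: complex_ring_simps)
  have pow: "x ^ i \<in> ?F" for i
  proof (induction i)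
    case (Suc i)
    then show ?case using generate_field.eng_mult[OF generate_field.incl[OF assms(2)] Suc]
      by (simp add: complex_ring_simps)
  qed (simp add: one)
  define Us where "Us = map (\<lambda>i. x ^ i) [0..<Suc d]"
  have "\<not> independent \<rat> Us"
  proof
    assume "independent \<rat> Us"
    then have "length Us \<le> dim \<rat> ?F"
      by (rule independent_length_le_dimension[OF subfield_Rats dimF]) (auto simp: Us_def pow)
    then show False using dim by (simp add: Us_def)
  qed
  moreover have "set Us \<subseteq> carrier complex_ring" by (simp add: complex_ring_simps)
  ultimately obtain Ks where Ks: "length Ks = length Us" "combine Ks Us = \<zero>\<^bsub>complex_ring\<^esub>"
      "set Ks \<subseteq> \<rat>" "set Ks \<noteq> {\<zero>\<^bsub>complex_ring\<^esub>}"
    using dependent_imp_non_trivial_combine[OF subfield_Rats] by metis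
  have len: "length Ks = Suc d" using Ks(1) by (simp add: Us_def)
  have "(\<Sum>i<Suc d. Ks ! i * x ^ i) = combine Ks Us"
    unfolding combine_complex_ring[OF Ks(1)] by (intro sum.cong) (auto simp: Us_def simp del: upt_Suc)
  then have sum0: "(\<Sum>i<Suc d. Ks ! i * x ^ i) = 0"
    using Ks(2) by (simp add: complex_ring_simps)
  \<comment> \<open>Nontriviality of \<open>Ks\<close> is expressed by \<open>set Ks\<close>
    differing from the singleton of zero, which an empty list satisfies as well; the length
    \<open>d + 1\<close> excludes that case.\<close>
  obtain i0 where i0: "i0 < Suc d" "Ks ! i0 \<noteq> 0"
  proof -
    have "set Ks \<noteq> {0}" using Ks(4) by (simp add: complex_ring_simps)
    moreover have "set Ks \<noteq> {}" using len by auto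
    ultimately obtain k where "k \<in> set Ks" "k \<noteq> 0" by (metis subset_singletonD subsetI singletonI)
    then show ?thesis using that len by (metis in_set_conv_nth)
  qed
  obtain D :: int where D: "D \<noteq> 0" "\<forall>q\<in>set Ks. of_int D * q \<in> \<int>"
    using clear_denominators[OF _ Ks(3)] by auto
  have "\<exists>a :: int. of_int D * Ks ! i = of_int a" if "i < Suc d" for i
    using D(2) that len by (metis nth_mem Ints_cases)
  then obtain a :: "nat \<Rightarrow> int" where a: "\<And>i. i < Suc d \<Longrightarrow> of_int D * Ks ! i = of_int (a i)" by metis
  define p where "p = (\<Sum>i<Suc d. Polynomial.monom (a i) i)"
  have cp: "Polynomial.coeff p i = (if i < Suc d then a i else 0)" for i
    by (simp add: p_def Polynomial.coeff_sum coeff_monom del: sum.lessThan_Suc)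
  have "a i0 \<noteq> 0" using a[OF i0(1)] i0(2) D(1) by auto
  then have "p \<noteq> 0" using cp[of i0] i0(1) by auto
  moreover have "Polynomial.degree p \<le> d" by (rule Polynomial.degree_le) (simp add: cp)
  moreover have "poly (of_int_poly p) x = of_int D * (\<Sum>i<Suc d. Ks ! i * x ^ i)"
    unfolding p_def sum_distrib_left
    by (simp add: hom_distribs poly_sum poly_monom a mult.assoc[symmetric] del: sum.lessThan_Suc)
  ultimately show ?thesis using sum0 by auto
qed

section \<open>Minimal polynomials over the integers and their coefficients\<close>

lemma irreducible_factor_with_root:
  fixes p :: "int poly" and x :: complex
  assumes "p \<noteq> 0" "poly (of_int_poly p) x = 0"
  shows "\<exists>q. Factorial_Ring.irreducible q \<and> q dvd p \<and> poly (of_int_poly q) x = 0"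
  using assms
proof (induction p rule: prime_divisors_induct)
  case (unit p)
  then obtain c where "p = [:c:]" "c dvd 1" by (auto simp: is_unit_poly_iff)
  then show ?case using unit by auto
next
  case (factor q p)
  have "poly (of_int_poly q) x = 0 \<or> poly (of_int_poly p) x = 0"
    using factor.prems by (simp add: hom_distribs)
  moreover have "Factorial_Ring.irreducible q"
    using factor.hyps by (intro prime_elem_imp_irreducible prime_imp_prime_elem)
  ultimately show ?case using factor.IH factor.prems by (metis dvd_mult dvd_triv_left mult_zero_right)
qed simp

text \<open>The point is that the \<open>THE\<close> in the definition denotes something. For
  existence take an irreducible factor, with normalised sign, of an annihilating polynomial of least
  degree. For uniqueness, this factor divides a constant multiple of any other candidate, and since
  it is prime and not constant it divides the candidate itself.\<close>

lemma min_int_poly: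
  fixes p :: "int poly" and x :: complex
  assumes p: "p \<noteq> 0" "poly (of_int_poly p) x = 0"
  shows "min_int_poly x \<noteq> 0" "poly (of_int_poly (min_int_poly x)) x = 0"
    "Polynomial.degree (min_int_poly x) \<le> Polynomial.degree p"
proof -
  let ?root = "\<lambda>q. q \<noteq> 0 \<and> poly (of_int_poly q) x = (0::complex)"
  obtain g0 where g0: "?root g0" "\<And>q. ?root q \<Longrightarrow> Polynomial.degree g0 \<le> Polynomial.degree q"
    using ex_has_least_nat[of ?root p Polynomial.degree] p by blast
  obtain g1 where g1: "Factorial_Ring.irreducible g1" "g1 dvd g0" "poly (of_int_poly g1) x = 0"
    using irreducible_factor_with_root[of g0 x] g0(1) by blast
  define g where "g = (if Polynomial.lead_coeff g1 > 0 then g1 else - g1)"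
  have g: "Factorial_Ring.irreducible g" "poly (of_int_poly g) x = 0"
    using g1 by (auto simp: g_def hom_distribs)
  have gnz: "g \<noteq> 0" using g(1) by auto
  have lg: "Polynomial.lead_coeff g > 0"
    using gnz by (auto simp: g_def not_less le_less split: if_splits)
  have "Polynomial.degree g = Polynomial.degree g1" by (simp add: g_def)
  then have gmin: "Polynomial.degree g \<le> Polynomial.degree q" if "?root q" for q
    using dvd_imp_degree_le[OF g1(2)] g0(1) g0(2)[OF that] by auto
  have uniq: "q = g" if q: "Factorial_Ring.irreducible q" "Polynomial.lead_coeff q > 0"
    "poly (of_int_poly q) x = 0" for q
  proof -
    \<comment> \<open>Division with remainder over the integers requires scaling the dividend by a
      constant \<open>c\<close>. The remainder vanishes at \<open>x\<close>, so minimality of the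
      degree of \<open>g\<close> makes it zero.\<close>
    define r where "r = pseudo_mod q g"
    obtain c s where cs: "c \<noteq> 0" "Polynomial.smult c q = g * s + r"
      using pseudo_mod(1)[OF gnz, of q] unfolding r_def by blast
    have "poly (of_int_poly (Polynomial.smult c q)) x = 0" using q(3) by (simp add: hom_distribs)
    then have "poly (of_int_poly r) x = 0" using g(2) unfolding cs(2) by (simp add: hom_distribs)
    moreover have "r = 0 \<or> Polynomial.degree r < Polynomial.degree g"
      using pseudo_mod(2)[OF gnz, of q] unfolding r_def .
    ultimately have "r = 0" using gmin[of r] by (cases "r = 0") auto
    then have "[:c:] * q = g * s" using cs(2) by simp
    then have "g dvd [:c:] * q" by simp
    moreover have "prime_elem g" using g(1) by (rule irreducible_imp_prime_elem)
    ultimately have "g dvd [:c:] \<or> g dvd q" by (simp only: prime_elem_dvd_mult_iff)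
    moreover have "\<not> g dvd [:c:]"
    proof
      assume "g dvd [:c:]"
      then have "Polynomial.degree g = 0" using dvd_imp_degree_le[of g "[:c:]"] cs(1) by simp
      then obtain b where "g = [:b:]" by (metis degree_eq_zeroE)
      then show False using g(2) gnz by simp
    qed
    ultimately have "g dvd q" by blast
    then obtain u where u: "q = g * u" by (elim dvdE)
    then have "is_unit g \<or> is_unit u" using Factorial_Ring.irreducibleD[OF q(1)] by blast
    then have "is_unit u" using Factorial_Ring.irreducible_not_unit[OF g(1)] by blast
    then obtain b where b: "u = [:b:]" "b dvd 1" by (auto simp: is_unit_poly_iff)
    then have "b = 1 \<or> b = -1" by auto
    then show "q = g"
    proof
      assume "b = -1"
      then have "q = - g" using u b(1) by simp
      then show ?thesis using q(2) lg by simp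
    qed (use u b(1) in simp)
  qed
  have eq: "min_int_poly x = g"
    unfolding min_int_poly_def by (rule the_equality) (use g lg in blast, use uniq in blast)
  show "min_int_poly x \<noteq> 0" "poly (of_int_poly (min_int_poly x)) x = 0"
    unfolding eq by (fact gnz, fact g(2))
  show "Polynomial.degree (min_int_poly x) \<le> Polynomial.degree p"
    unfolding eq using gmin[of p] p by blast
qed

text \<open>Undoing the root bounds the Mahler measure by \<open>H ^ n\<close>. The Mignotte bound
  passes from there to the coefficients at the price of a binomial coefficient, which is at most
  \<open>2 ^ d\<close>, and there are at most \<open>d + 1\<close> coefficients.\<close>

lemma int_algebraic_of_height:
  assumes S: "degree_over_Q S \<le> enat d" "x \<in> S" and ht: "alg_height x \<le> H" and H: "1 \<le> H"
  shows "int_algebraic d (real (d + 1) * (2 * H) ^ d) x"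
proof -
  obtain p0 :: "int poly" where p0: "p0 \<noteq> 0" "Polynomial.degree p0 \<le> d" "poly (of_int_poly p0) x = 0"
    using int_poly_root_of_degree_over_Q[OF S] by blast
  define p where "p = min_int_poly x"
  define n where "n = Polynomial.degree p"
  have p: "p \<noteq> 0" "poly (of_int_poly p) x = 0" and nd: "n \<le> d"
    using min_int_poly[OF p0(1,3)] p0(2) by (auto simp: p_def n_def)
  \<comment> \<open>\<open>root 0\<close> is constantly 0, so in degree 0 the height would say
    nothing about the Mahler measure.\<close>
  have "n \<noteq> 0"
  proof
    assume "n = 0"
    then obtain b where "p = [:b:]" unfolding n_def by (metis degree_eq_zeroE)
    then show False using p by simp
  qed
  then have n: "0 < n" by simp
  have "root n (mahler_measure p) \<le> H" using ht by (simp add: alg_height_def p_def n_def)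
  moreover have "0 \<le> root n (mahler_measure p)" using mahler_measure_ge_0 n by simp
  ultimately have "root n (mahler_measure p) ^ n \<le> H ^ n" by (intro power_mono)
  then have "mahler_measure p \<le> H ^ n" using n mahler_measure_ge_0 by simp
  also have "\<dots> \<le> H ^ d" using nd H by (rule power_increasing)
  finally have M: "mahler_measure p \<le> H ^ d" .
  have coeff: "real_of_int \<bar>Polynomial.coeff p i\<bar> \<le> (2 * H) ^ d" if "i \<le> n" for i
  proof -
    have "real_of_int \<bar>Polynomial.coeff p i\<bar> \<le> real (n choose i) * mahler_measure p"
      unfolding n_def by (rule Mignotte_bound)
    also have "\<dots> \<le> 2 ^ d * H ^ d"
    proof (rule mult_mono)
      have "n choose i \<le> 2 ^ n" by (rule binomial_le_pow2)
      also have "(2::nat) ^ n \<le> 2 ^ d" using nd by (intro power_increasing) auto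
      finally have "real (n choose i) \<le> real (2 ^ d)" by (simp only: of_nat_le_iff)
      then show "real (n choose i) \<le> 2 ^ d" by simp
    qed (use M mahler_measure_ge_0 in auto)
    finally show ?thesis by (simp add: power_mult_distrib)
  qed
  have "(\<Sum>i\<le>n. real_of_int \<bar>Polynomial.coeff p i\<bar>) \<le> (\<Sum>i\<le>n. (2 * H) ^ d)"
    using coeff by (intro sum_mono) auto
  also have "\<dots> = real (n + 1) * (2 * H) ^ d" by (simp only: sum_constant card_atMost Suc_eq_plus1)
  also have "\<dots> \<le> real (d + 1) * (2 * H) ^ d"
    using nd H by (intro mult_right_mono) auto
  finally show ?thesis
    unfolding int_algebraic_def using p nd unfolding n_def by blast
qed

section \<open>Zeros of entire functions\<close>

text \<open>Each point is divided out once, whatever the multiplicity of the zero; the quotient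
  extends over the point because the singularity is removable.\<close>

lemma entire_factor_zeros:
  fixes g :: "complex \<Rightarrow> complex"
  assumes "finite Z" "g holomorphic_on UNIV" "\<And>a. a \<in> Z \<Longrightarrow> g a = 0"
  shows "\<exists>h. h holomorphic_on UNIV \<and> (\<forall>z. g z = h z * (\<Prod>a\<in>Z. z - a))"
  using assms(1,3)
proof (induction Z rule: finite_induct)
    case empty
    then show ?case using assms(2) by auto
  next
    case (insert b Z)
    then obtain h where h: "h holomorphic_on UNIV" "\<And>z. g z = h z * (\<Prod>a\<in>Z. z - a)"
      by auto
    define h' where "h' = (\<lambda>z. if z = b then deriv h b else (h z - h b) / (z - b))"
    have "g b = 0" using insert.prems by blast
    moreover have "(\<Prod>a\<in>Z. b - a) \<noteq> 0" using insert.hyps by auto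
    ultimately have hb: "h b = 0" using h(2)[of b] by auto
    have "h' holomorphic_on UNIV"
      unfolding h'_def using pole_lemma_open[OF h(1) open_UNIV] .
    moreover have "g z = h' z * (\<Prod>a\<in>insert b Z. z - a)" for z
    proof (cases "z = b")
      case True
      then show ?thesis using insert.hyps \<open>g b = 0\<close> by simp
    next
      case False
      then have "h z = h' z * (z - b)" by (simp add: h'_def hb)
      then show ?thesis using insert.hyps h(2)[of z] by (simp add: mult.assoc)
    qed
    ultimately show ?case by blast
  qed
text \<open>A form of the Schwarz lemma: dividing out the zeros, the quotient is estimated on the
  sphere of radius \<open>9 R\<close>, where every factor \<open>z - a\<close> is at least four times as large as on the disc
  of radius \<open>R\<close>.\<close>
lemma norm_le_of_zeros:
  fixes g :: "complex \<Rightarrow> complex"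
  assumes Z: "finite Z" "Z \<subseteq> cball 0 R" "\<And>a. a \<in> Z \<Longrightarrow> g a = 0"
    and g: "g holomorphic_on UNIV" and R: "0 < R"
    and M: "\<And>z. cmod z = 9 * R \<Longrightarrow> cmod (g z) \<le> M"
    and z: "cmod z \<le> R"
  shows "cmod (g z) * 4 ^ card Z \<le> M"
proof -
  obtain h where h: "h holomorphic_on UNIV" "\<And>z. g z = h z * (\<Prod>a\<in>Z. z - a)"
    using entire_factor_zeros[OF Z(1) g Z(3)] by auto
  have "cmod (h z) \<le> M / (8 * R) ^ card Z"
  proof (rule maximum_modulus_frontier[where f = h and S = "cball 0 (9 * R)"])
    show "h holomorphic_on interior (cball 0 (9 * R))"
      using h(1) holomorphic_on_subset by blast
    show "continuous_on (closure (cball 0 (9 * R))) h"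
      using h(1) holomorphic_on_imp_continuous_on continuous_on_subset by blast
    show "z \<in> cball 0 (9 * R)" using z R by auto
    fix w :: complex
    assume "w \<in> frontier (cball 0 (9 * R))"
    then have w: "cmod w = 9 * R" using R by auto
    have "(8 * R) ^ card Z = (\<Prod>a\<in>Z. 8 * R)" by simp
    also have "\<dots> \<le> (\<Prod>a\<in>Z. cmod (w - a))"
    proof (rule prod_mono)
      fix a assume "a \<in> Z"
      then have "cmod a \<le> R" using Z(2) by auto
      then show "0 \<le> 8 * R \<and> 8 * R \<le> cmod (w - a)"
        using norm_triangle_ineq2[of w a] w R by auto
    qed
    finally have *: "(8 * R) ^ card Z \<le> (\<Prod>a\<in>Z. cmod (w - a))" .
    have "cmod (h w) * (8 * R) ^ card Z \<le> cmod (h w) * (\<Prod>a\<in>Z. cmod (w - a))"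
      using * by (simp add: mult_left_mono)
    also have "\<dots> = cmod (g w)" by (simp add: h(2) norm_mult prod_norm)
    also have "\<dots> \<le> M" using M w by blast
    finally show "cmod (h w) \<le> M / (8 * R) ^ card Z" using R by (simp add: pos_le_divide_eq)
  qed auto
  then have hM: "cmod (h z) * (8 * R) ^ card Z \<le> M" using R by (simp add: pos_le_divide_eq)
  have "(\<Prod>a\<in>Z. cmod (z - a)) \<le> (\<Prod>a\<in>Z. 2 * R)"
  proof (rule prod_mono)
    fix a assume "a \<in> Z"
    then have "cmod a \<le> R" using Z(2) by auto
    then show "0 \<le> cmod (z - a) \<and> cmod (z - a) \<le> 2 * R"
      using norm_triangle_ineq4[of z a] z by auto
  qed
  then have "(\<Prod>a\<in>Z. cmod (z - a)) * 4 ^ card Z \<le> (2 * R) ^ card Z * 4 ^ card Z"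
    by simp
  also have "\<dots> = (2 * R * 4) ^ card Z" by (simp only: power_mult_distrib)
  also have "2 * R * 4 = 8 * R" by simp
  finally have "cmod (h z) * ((\<Prod>a\<in>Z. cmod (z - a)) * 4 ^ card Z) \<le> cmod (h z) * (8 * R) ^ card Z"
    by (simp add: mult_left_mono)
  then show ?thesis using hM by (simp add: h(2) norm_mult prod_norm mult.assoc)
qed

section \<open>Growth of the canonical product\<close>

text \<open>For \<open>c = cos \<phi>\<close> this is the logarithm of the modulus of 1 - e^(i
  \<phi>) / u: one factor of the product on the boundary ray of the sector, where \<open>u\<close>
  is the zero divided by the radius.\<close>

definition log_kernel :: "real \<Rightarrow> real \<Rightarrow> real" where
  "log_kernel c u = ln (u\<^sup>2 - 2 * c * u + 1) / 2 - ln u"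

definition log_kernel_rate :: "real \<Rightarrow> real \<Rightarrow> real" where
  "log_kernel_rate c u = (1 - c * u) / (u * (u\<^sup>2 - 2 * c * u + 1))"

lemma quadratic_pos:
  fixes c u :: real assumes "0 < c" "c < 1"
  shows "0 < u\<^sup>2 - 2 * c * u + 1"
proof -
  have "c\<^sup>2 < 1" using assms by (simp add: power_less_one_iff abs_square_less_1)
  then have "0 < (u - c)\<^sup>2 + (1 - c\<^sup>2)" by (intro add_nonneg_pos) auto
  also have "\<dots> = u\<^sup>2 - 2 * c * u + 1" by (simp add: power2_eq_square algebra_simps)
  finally show ?thesis .
qed

lemma log_kernel_deriv:
  assumes "0 < c" "c < 1" "0 < u"
  shows "(log_kernel c has_real_derivative - log_kernel_rate c u) (at u)"
proof -
  let ?q = "u\<^sup>2 - 2 * c * u + 1"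
  have q: "0 < ?q" by (rule quadratic_pos[OF assms(1,2)])
  have "((\<lambda>u. u\<^sup>2 - 2 * c * u + 1) has_real_derivative 2 * u - 2 * c) (at u)"
    by (auto intro!: derivative_eq_intros)
  then have "(log_kernel c has_real_derivative 1 / ?q * (2 * u - 2 * c) / 2 - 1 / u) (at u)"
    unfolding log_kernel_def[abs_def]
    by (intro DERIV_diff DERIV_cdivide DERIV_chain2[OF DERIV_ln_divide] DERIV_ln_divide q assms(3))
  moreover have "1 / Q * (2 * u - 2 * c) / 2 - 1 / u = ((u - c) * u - Q) / (u * Q)" if "0 < Q" for Q
  proof -
    have "2 * u - 2 * c = 2 * (u - c)" by simp
    then show ?thesis using that assms(3) by (simp add: diff_divide_distrib)
  qed
  note this[OF q]
  moreover have "(u - c) * u - ?q = - (1 - c * u)" by (simp add: power2_eq_square algebra_simps)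
  ultimately show ?thesis by (simp only: log_kernel_rate_def minus_divide_left)
qed

text \<open>For \<open>c = cos \<phi>\<close> the primitive constructed in the proof tends to \<open>\<pi> sin (\<phi>/2)\<close>, the value at \<open>\<rho> = 1/2\<close> of the
  classical indicator \<open>\<pi> cos (\<rho> (\<pi> - \<phi>)) / sin (\<pi> \<rho>)\<close>.\<close>
lemma log_kernel_sqrt_primitive:
  assumes c: "0 < c" "c < 1"
  shows "\<exists>\<Psi> \<kappa>. (\<forall>u>0. (\<Psi> has_real_derivative sqrt u * log_kernel_rate c u) (at u)) \<and>
     (\<Psi> \<longlongrightarrow> 0) (at_right 0) \<and> (\<Psi> \<longlongrightarrow> \<kappa>) at_top \<and> 0 < (\<kappa>::real)"
proof -
  \<comment> \<open>Half angles: for \<open>c = cos \<phi>\<close> these are cos (\<phi>/2) and sin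
    (\<phi>/2). The substitution \<open>u = v\<^sup>2\<close> leads to the denominator
    \<open>v ^ 4 - 2 * c * v\<^sup>2 + 1\<close>, which is the product of the quadratics in
    \<open>f1\<close> and \<open>f2\<close>.\<close>
  define p where "p = sqrt ((1 + c) / 2)"
  define q where "q = sqrt ((1 - c) / 2)"
  have p: "0 < p" "p\<^sup>2 = (1 + c) / 2" and q: "0 < q" "q\<^sup>2 = (1 - c) / 2"
    using c by (auto simp: p_def q_def)
  have pq: "p\<^sup>2 + q\<^sup>2 = 1" "p\<^sup>2 - q\<^sup>2 = c" by (simp_all add: p(2) q(2) field_simps)
  have f1: "0 < v\<^sup>2 + 2 * p * v + 1" and f2: "0 < v\<^sup>2 - 2 * p * v + 1" for v
  proof -
    have "v\<^sup>2 + 2 * p * v + 1 = (v + p)\<^sup>2 + q\<^sup>2" "v\<^sup>2 - 2 * p * v + 1 = (v - p)\<^sup>2 + q\<^sup>2"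
      using pq(1) by (simp_all add: power2_eq_square algebra_simps)
    then show "0 < v\<^sup>2 + 2 * p * v + 1" "0 < v\<^sup>2 - 2 * p * v + 1"
      using q(1) by (simp_all add: add_nonneg_pos)
  qed
  \<comment> \<open>Found by partial fractions over the two quadratics; the arctangents come from
    completing the squares to \<open>(v + p)\<^sup>2 + q\<^sup>2\<close> and
    \<open>(v - p)\<^sup>2 + q\<^sup>2\<close>.\<close>
  define G where "G = (\<lambda>v. p / 4 * (ln (v\<^sup>2 + 2 * p * v + 1) - ln (v\<^sup>2 - 2 * p * v + 1)) +
      q / 2 * (arctan ((v + p) / q) + arctan ((v - p) / q)))"
  have G': "(G has_real_derivative (1 - c * v\<^sup>2) / (v ^ 4 - 2 * c * v\<^sup>2 + 1)) (at v)" for v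
  proof -
    let ?a = "v\<^sup>2 + 2 * p * v + 1" and ?b = "v\<^sup>2 - 2 * p * v + 1"
    have d: "((\<lambda>v. v\<^sup>2 + 2 * p * v + 1) has_real_derivative 2 * v + 2 * p) (at v)"
      "((\<lambda>v. v\<^sup>2 - 2 * p * v + 1) has_real_derivative 2 * v - 2 * p) (at v)"
      "((\<lambda>v. (v + p) / q) has_real_derivative 1 / q) (at v)"
      "((\<lambda>v. (v - p) / q) has_real_derivative 1 / q) (at v)"
      using q(1) by (auto intro!: derivative_eq_intros)
    have "(G has_real_derivative p / 4 * (1 / ?a * (2 * v + 2 * p) - 1 / ?b * (2 * v - 2 * p)) +
       q / 2 * (inverse (1 + ((v + p) / q)\<^sup>2) * (1 / q) + inverse (1 + ((v - p) / q)\<^sup>2) * (1 / q))) (at v)"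
      unfolding G_def
      by (intro DERIV_add DERIV_cmult DERIV_diff DERIV_chain2[OF DERIV_ln_divide d(1)]
          DERIV_chain2[OF DERIV_ln_divide d(2)] DERIV_chain2[OF DERIV_arctan d(3)]
          DERIV_chain2[OF DERIV_arctan d(4)] f1 f2)
    moreover have "inverse (1 + ((v + p) / q)\<^sup>2) * (1 / q) = q / ?a"
    proof -
      have "1 + ((v + p) / q)\<^sup>2 = q\<^sup>2 / q\<^sup>2 + (v + p)\<^sup>2 / q\<^sup>2"
        using q(1) by (simp add: power_divide)
      also have "\<dots> = (q\<^sup>2 + (v + p)\<^sup>2) / q\<^sup>2" by (simp only: add_divide_distrib)
      also have "q\<^sup>2 + (v + p)\<^sup>2 = ?a" using pq(1) by (simp add: power2_eq_square algebra_simps)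
      finally show ?thesis using q(1) by (simp add: power2_eq_square)
    qed
    moreover have "inverse (1 + ((v - p) / q)\<^sup>2) * (1 / q) = q / ?b"
    proof -
      have "1 + ((v - p) / q)\<^sup>2 = q\<^sup>2 / q\<^sup>2 + (v - p)\<^sup>2 / q\<^sup>2"
        using q(1) by (simp add: power_divide)
      also have "\<dots> = (q\<^sup>2 + (v - p)\<^sup>2) / q\<^sup>2" by (simp only: add_divide_distrib)
      also have "q\<^sup>2 + (v - p)\<^sup>2 = ?b" using pq(1) by (simp add: power2_eq_square algebra_simps)
      finally show ?thesis using q(1) by (simp add: power2_eq_square)
    qed
    moreover have "p / 4 * ((2 * v + 2 * p) / ?a - (2 * v - 2 * p) / ?b) + q / 2 * (q / ?a + q / ?b)
       = (1 - c * v\<^sup>2) / (v ^ 4 - 2 * c * v\<^sup>2 + 1)"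
    proof -
      have "p / 4 * ((2 * v + 2 * p) / ?a - (2 * v - 2 * p) / ?b) + q / 2 * (q / ?a + q / ?b)
        = (p / 4 * ((2 * v + 2 * p) * ?b - (2 * v - 2 * p) * ?a) + q\<^sup>2 / 2 * (?b + ?a)) / (?a * ?b)"
        (is "_ = ?rhs")
      proof -
        have aux: "p / 4 * (x / a - y / b) + q / 2 * (q / a + q / b) = (p / 4 * (x * b - y * a) + q\<^sup>2 / 2 * (b + a)) / (a * b)"
          if "0 < a" "0 < b" for x y a b :: real
        proof -
          have "x / a = x * b / (a * b)" "y / b = y * a / (a * b)" "q / a = q * b / (a * b)" "q / b = q * a / (a * b)"
            using that by simp_all
          then show ?thesis
            by (simp only: diff_divide_distrib[symmetric] add_divide_distrib[symmetric] times_divide_eq_right)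
               (simp add: power2_eq_square algebra_simps add_divide_distrib diff_divide_distrib)
        qed
        show ?thesis by (rule aux[OF f1 f2])
      qed
      also have "p / 4 * ((2 * v + 2 * p) * ?b - (2 * v - 2 * p) * ?a) + q\<^sup>2 / 2 * (?b + ?a)
        = (p\<^sup>2 + q\<^sup>2) - (p\<^sup>2 - q\<^sup>2) * v\<^sup>2"
        by (simp add: power2_eq_square algebra_simps)
      also have "\<dots> = 1 - c * v\<^sup>2" by (simp add: pq)
      also have "?a * ?b = v ^ 4 - 2 * c * v\<^sup>2 + 1"
      proof -
        have "?a * ?b = v ^ 4 - 2 * (2 * p\<^sup>2 - 1) * v\<^sup>2 + 1"
          by (simp add: power2_eq_square power4_eq_xxxx algebra_simps)
        then show ?thesis by (simp add: p(2))
      qed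
      finally show ?thesis .
    qed
    ultimately show ?thesis by (simp only: times_divide_eq_left mult_1)
  qed
  have G0: "(G \<longlongrightarrow> 0) (at_right 0)"
  proof -
    have "isCont G 0" using G' DERIV_isCont by blast
    moreover have "G 0 = 0" by (simp add: G_def minus_divide_left[symmetric] arctan_minus)
    ultimately show ?thesis unfolding isCont_def using filterlim_at_split by metis
  qed
  have Ginf: "(G \<longlongrightarrow> q * pi / 2) at_top"
  proof -
    have "((\<lambda>v. ln (v\<^sup>2 + 2 * p * v + 1) - ln (v\<^sup>2 - 2 * p * v + 1)) \<longlongrightarrow> 0) at_top"
      using p(1) by real_asymp
    moreover have "filterlim (\<lambda>v. (v + p) / q) at_top at_top" "filterlim (\<lambda>v. (v - p) / q) at_top at_top"
      using q(1) by real_asymp+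
    then have "((\<lambda>v. arctan ((v + p) / q)) \<longlongrightarrow> pi / 2) at_top" "((\<lambda>v. arctan ((v - p) / q)) \<longlongrightarrow> pi / 2) at_top"
      using filterlim_compose[OF tendsto_arctan_at_top] by blast+
    ultimately have "(G \<longlongrightarrow> p / 4 * 0 + q / 2 * (pi / 2 + pi / 2)) at_top"
      unfolding G_def by (intro tendsto_intros)
    then show ?thesis by simp
  qed
  \<comment> \<open>Under \<open>v = sqrt u\<close> the required integrand becomes twice the
    derivative of \<open>G\<close>.\<close>
  define \<Psi> where "\<Psi> = (\<lambda>u. 2 * G (sqrt u))"
  have "(\<Psi> has_real_derivative sqrt u * log_kernel_rate c u) (at u)" if u: "0 < u" for u
  proof -
    have "(\<Psi> has_real_derivative 2 * ((1 - c * (sqrt u)\<^sup>2) / (sqrt u ^ 4 - 2 * c * (sqrt u)\<^sup>2 + 1) * (inverse (sqrt u) / 2))) (at u)"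
      unfolding \<Psi>_def by (intro DERIV_cmult DERIV_chain2[OF G'] DERIV_real_sqrt u)
    moreover have "sqrt u ^ 4 = u\<^sup>2"
    proof -
      have "sqrt u ^ 4 = ((sqrt u)\<^sup>2)\<^sup>2" by (simp only: power4_eq_xxxx power2_eq_square mult.assoc)
      then show ?thesis using u by simp
    qed
    moreover have "2 * ((1 - c * u) / (u\<^sup>2 - 2 * c * u + 1) * (inverse (sqrt u) / 2)) = sqrt u * log_kernel_rate c u"
    proof -
      have "inverse (sqrt u) = sqrt u / u" using u by (simp add: field_simps)
      moreover have "2 * (x / Q * (w / u / 2)) = w * (x / (u * Q))" for x Q w :: real
        by (simp add: mult.commute)
      ultimately show ?thesis unfolding log_kernel_rate_def by (simp only:)
    qed
    ultimately show ?thesis using u by simp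
  qed
  moreover have "(\<Psi> \<longlongrightarrow> 2 * 0) (at_right 0)"
  proof -
    have "filterlim sqrt (at_right 0) (at_right 0)" by real_asymp
    then show ?thesis unfolding \<Psi>_def by (intro tendsto_intros filterlim_compose[OF G0])
  qed
  moreover have "(\<Psi> \<longlongrightarrow> 2 * (q * pi / 2)) at_top"
    unfolding \<Psi>_def by (intro tendsto_intros filterlim_compose[OF Ginf] sqrt_at_top)
  moreover have "0 < 2 * (q * pi / 2)" using q(1) by simp
  ultimately show ?thesis by (metis mult_zero_right)
qed

text \<open>Each difference \<open>log_kernel c (b n) - log_kernel c x\<close> is the integral of
  the rate from \<open>b n\<close> to \<open>x\<close>, so the sum is a boundary term at
  \<open>x\<close> plus the integral of the rate times the number of \<open>b n\<close> below
  \<open>u\<close>. Below \<open>u0\<close> the integrand is nonnegative and is dropped. From there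
  to \<open>1 / c\<close> a lower bound for the count is used, and beyond \<open>1 / c\<close>,
  where the rate is not positive, an upper bound; hence the two constants \<open>p\<close> and
  \<open>q\<close>.\<close>

lemma sum_log_kernel_lower:
  fixes b :: "'a \<Rightarrow> real"
  assumes c: "0 < c" "c < 1" and A: "finite A" and b: "\<And>n. n \<in> A \<Longrightarrow> l \<le> b n \<and> b n \<le> x"
    and l: "0 < l" "l \<le> u0" "u0 \<le> 1 / c" "1 / c \<le> x"
    and \<Psi>: "\<And>u. 0 < u \<Longrightarrow> (\<Psi> has_real_derivative sqrt u * log_kernel_rate c u) (at u)"
    and below: "\<And>u. u0 \<le> u \<Longrightarrow> u \<le> 1 / c \<Longrightarrow> p * sqrt u \<le> card {n\<in>A. b n < u}"
    and above: "\<And>u. 1 / c \<le> u \<Longrightarrow> u \<le> x \<Longrightarrow> card {n\<in>A. b n < u} \<le> q * sqrt u"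
  shows "card A * log_kernel c x + p * (\<Psi> (1 / c) - \<Psi> u0) + q * (\<Psi> x - \<Psi> (1 / c))
     \<le> (\<Sum>n\<in>A. log_kernel c (b n))"
proof -
  let ?k = "log_kernel_rate c" and ?F = "log_kernel c"
  define g where "g u = real (card {n\<in>A. b n < u}) * ?k u" for u
  have cu: "c * u \<le> 1 \<longleftrightarrow> u \<le> 1 / c" "1 \<le> c * u \<longleftrightarrow> 1 / c \<le> u" for u
    using c(1) by (simp_all only: pos_le_divide_eq pos_divide_le_eq mult.commute[of c])
  have kpos: "0 \<le> ?k u" if "0 < u" "u \<le> 1 / c" for u
    unfolding log_kernel_rate_def
    by (intro divide_nonneg_pos mult_pos_pos quadratic_pos[OF c] that(1)) (use that cu in simp)
  have kneg: "?k u \<le> 0" if "1 / c \<le> u" for u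
  proof -
    have "0 < 1 / c" using c(1) by simp
    then have "0 < u" using that by linarith
    then show ?thesis unfolding log_kernel_rate_def
      by (intro divide_nonpos_pos mult_pos_pos quadratic_pos[OF c]) (use that cu in simp_all)
  qed
  have single: "((\<lambda>u. if b n < u then ?k u else 0) has_integral (?F (b n) - ?F x)) {l..x}" if n: "n \<in> A" for n
  proof -
    have "(?k has_integral (- ?F x - (- ?F (b n)))) {b n..x}"
    proof (rule fundamental_theorem_of_calculus)
      fix u assume "u \<in> {b n..x}"
      then have "0 < u" using b[OF n] l(1) by auto
      then have "((\<lambda>u. - ?F u) has_real_derivative ?k u) (at u)"
        using DERIV_minus[OF log_kernel_deriv[OF c]] by simp
      then show "((\<lambda>u. - ?F u) has_vector_derivative ?k u) (at u within {b n..x})"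
        by (simp add: has_real_derivative_iff_has_vector_derivative has_vector_derivative_at_within)
    qed (use b[OF n] in simp)
    then have "((\<lambda>u. if u \<in> {b n..x} then ?k u else 0) has_integral (?F (b n) - ?F x)) {l..x}"
      using b[OF n] by (subst has_integral_restrict) auto
    \<comment> \<open>The condition \<open>b n < u\<close> and the closed interval differ only in
      the point \<open>b n\<close>.\<close>
    then show ?thesis
      by (rule has_integral_spike[OF negligible_sing[of "b n"], rotated]) auto
  qed
  have "((\<lambda>u. \<Sum>n\<in>A. if b n < u then ?k u else 0) has_integral (\<Sum>n\<in>A. ?F (b n) - ?F x)) {l..x}"
    by (intro has_integral_sum A single)
  moreover have "(\<lambda>u. \<Sum>n\<in>A. if b n < u then ?k u else 0) = g"
  proof
    fix u
    have "(\<Sum>n\<in>A. if b n < u then ?k u else 0) = (\<Sum>n\<in>{n\<in>A. b n < u}. ?k u)"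
      by (intro sum.mono_neutral_cong_right) (use A in auto)
    then show "(\<Sum>n\<in>A. if b n < u then ?k u else 0) = g u" by (simp add: g_def)
  qed
  ultimately have g: "(g has_integral (\<Sum>n\<in>A. ?F (b n) - ?F x)) {l..x}" by simp
  then have gint: "g integrable_on {l..x}" by blast
  have sub: "g integrable_on {v..w}" if "l \<le> v" "w \<le> x" for v w
    by (rule integrable_on_subinterval[OF gint]) (use that in auto)
  have "integral {l..x} g = integral {l..u0} g + integral {u0..x} g"
    by (rule Henstock_Kurzweil_Integration.integral_combine[symmetric]) (use l gint in auto)
  also have "integral {u0..x} g = integral {u0..1/c} g + integral {1/c..x} g"
    by (rule Henstock_Kurzweil_Integration.integral_combine[symmetric]) (use l sub in auto)
  finally have split: "integral {l..x} g = integral {l..u0} g + (integral {u0..1/c} g + integral {1/c..x} g)" .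
  have prim: "((\<lambda>u. t * (sqrt u * ?k u)) has_integral t * (\<Psi> w - \<Psi> v)) {v..w}" if "0 < v" "v \<le> w" for t v w
  proof (rule has_integral_mult_right, rule fundamental_theorem_of_calculus)
    fix u assume "u \<in> {v..w}"
    then have "0 < u" using that by auto
    then show "(\<Psi> has_vector_derivative sqrt u * ?k u) (at u within {v..w})"
      using \<Psi> by (simp add: has_real_derivative_iff_has_vector_derivative has_vector_derivative_at_within)
  qed (use that in simp)
  have "0 \<le> integral {l..u0} g"
  proof (rule Henstock_Kurzweil_Integration.integral_nonneg)
    show "g integrable_on {l..u0}" using sub l by auto
    fix u assume "u \<in> {l..u0}"
    then show "0 \<le> g u" using kpos[of u] l by (auto simp: g_def)
  qed
  moreover have "p * (\<Psi> (1 / c) - \<Psi> u0) \<le> integral {u0..1/c} g"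
  proof (rule has_integral_le)
    show "(g has_integral integral {u0..1/c} g) {u0..1/c}"
      using sub[of u0 "1/c"] l by (auto intro: integrable_integral)
    show "((\<lambda>u. p * (sqrt u * ?k u)) has_integral p * (\<Psi> (1/c) - \<Psi> u0)) {u0..1/c}"
      using l by (intro prim) auto
    fix u assume u: "u \<in> {u0..1/c}"
    then have "0 \<le> ?k u" using l by (intro kpos) auto
    then have "p * sqrt u * ?k u \<le> g u"
      unfolding g_def using below[of u] u by (intro mult_right_mono) auto
    then show "p * (sqrt u * ?k u) \<le> g u" by (simp only: mult.assoc)
  qed
  moreover have "q * (\<Psi> x - \<Psi> (1 / c)) \<le> integral {1/c..x} g"
  proof (rule has_integral_le)
    show "(g has_integral integral {1/c..x} g) {1/c..x}"
      using sub[of "1/c" x] l by (auto intro: integrable_integral)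
    show "((\<lambda>u. q * (sqrt u * ?k u)) has_integral q * (\<Psi> x - \<Psi> (1/c))) {1/c..x}"
      using l c by (intro prim) auto
    fix u assume u: "u \<in> {1/c..x}"
    then have "?k u \<le> 0" by (intro kneg) auto
    then have "q * sqrt u * ?k u \<le> g u"
      unfolding g_def using above[of u] u by (intro mult_right_mono_neg) auto
    then show "q * (sqrt u * ?k u) \<le> g u" by (simp only: mult.assoc)
  qed
  moreover have "integral {l..x} g = (\<Sum>n\<in>A. ?F (b n)) - card A * ?F x"
    using integral_unique[OF g] by (simp add: sum_subtractf)
  ultimately show ?thesis using split by linarith
qed

section \<open>Single factors of the product off the sector\<close>

lemma norm_one_minus_ge_exp_log_kernel:
  assumes c: "0 < c" "c < 1" and z: "Re z \<le> c * cmod z" "z \<noteq> 0" and a: "0 < a"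
  shows "exp (log_kernel c (a / cmod z)) \<le> cmod (1 - z / of_real a)"
proof (rule power2_le_imp_le)
  let ?r = "cmod z"
  let ?u = "a / ?r"
  have r: "0 < ?r" using z(2) by simp
  then have u: "0 < ?u" using a by simp
  have q: "0 < ?u\<^sup>2 - 2 * c * ?u + 1" by (rule quadratic_pos[OF c])
  have "(exp (log_kernel c ?u))\<^sup>2 = exp (ln (?u\<^sup>2 - 2 * c * ?u + 1) - 2 * ln ?u)"
  proof -
    have "ln (?u\<^sup>2 - 2 * c * ?u + 1) - 2 * ln ?u = 2 * log_kernel c ?u" by (simp add: log_kernel_def)
    then show ?thesis by (simp only: exp_double)
  qed
  also have "\<dots> = (?u\<^sup>2 - 2 * c * ?u + 1) / ?u\<^sup>2"
    using q u by (simp only: exp_diff exp_double exp_ln)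
  also have "\<dots> = 1 - 2 * c * ?r / a + ?r\<^sup>2 / a\<^sup>2"
  proof -
    have "(v\<^sup>2 - 2 * c * v + 1) / v\<^sup>2 = 1 - 2 * c * (1 / v) + (1 / v)\<^sup>2" if "0 < v" for v
      using that by (simp add: add_divide_distrib diff_divide_distrib power2_eq_square)
    from this[OF u] show ?thesis by (simp add: power_divide)
  qed
  \<comment> \<open>The only inequality of the chain; it is an equality when
    \<open>Re z = c * cmod z\<close>, that is on the boundary rays.\<close>
  also have "\<dots> \<le> 1 - 2 * Re z / a + ?r\<^sup>2 / a\<^sup>2"
    using z(1) a by (simp add: divide_right_mono)
  also have "\<dots> = (cmod (1 - z / of_real a))\<^sup>2"
  proof -
    have "(cmod (1 - z / of_real a))\<^sup>2 = (1 - Re z / a)\<^sup>2 + (Im z / a)\<^sup>2"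
      by (simp add: cmod_power2)
    also have "\<dots> = 1 - 2 * (Re z / a) + ((Re z)\<^sup>2 + (Im z)\<^sup>2) / a\<^sup>2"
      by (simp add: power2_diff power_divide add_divide_distrib)
    finally show ?thesis by (simp add: cmod_power2)
  qed
  finally show "(exp (log_kernel c ?u))\<^sup>2 \<le> (cmod (1 - z / of_real a))\<^sup>2" .
qed simp

lemma Re_le_of_notin_sector:
  assumes "0 < \<phi>" "\<phi> < pi / 2" "z \<notin> sector \<phi>"
  shows "z \<noteq> 0" "Re z \<le> cos \<phi> * cmod z"
proof -
  show "z \<noteq> 0" using assms by (auto simp: sector_def Arg_zero)
  have "\<phi> \<le> \<bar>Arg z\<bar>" using assms(3) by (auto simp: sector_def)
  moreover have "\<bar>Arg z\<bar> \<le> pi" using Arg_bounded[of z] by auto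
  ultimately have "cos \<bar>Arg z\<bar> \<le> cos \<phi>" using assms by (intro cos_monotone_0_pi_le) auto
  then have "cos (Arg z) \<le> cos \<phi>" by (simp add: abs_if split: if_splits)
  then have "cmod z * cos (Arg z) \<le> cmod z * cos \<phi>" by (intro mult_left_mono) auto
  moreover have "Re z = cmod z * cos (Arg z)"
    using \<open>z \<noteq> 0\<close> by (metis Re_rcis rcis_cmod_Arg)
  ultimately show "Re z \<le> cos \<phi> * cmod z" by (simp add: mult.commute)
qed

section \<open>The canonical product: convergence, upper bound and growth off the sector\<close>

lemma canonical_product_tendsto:
  fixes a :: "nat \<Rightarrow> real" and z :: complex
  assumes a: "\<And>n. 1 \<le> a n" "summable (\<lambda>n. 1 / a n)"
    and f: "\<And>z. f z = (\<Prod>n. 1 - z / complex_of_real (a n))"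
  shows "(\<lambda>N. \<Prod>n<N. 1 - z / complex_of_real (a n)) \<longlonglongrightarrow> f z"
proof -
  have "norm (1 - z / complex_of_real (a n) - 1) = cmod z * (1 / a n)" for n
    using a(1)[of n] by (simp add: norm_divide)
  then have "summable (\<lambda>n. norm (1 - z / complex_of_real (a n) - 1))"
    using summable_mult[OF a(2), of "cmod z"] by (simp only:)
  then have "convergent_prod (\<lambda>n. 1 - z / complex_of_real (a n))"
    by (intro abs_convergent_prod_imp_convergent_prod summable_imp_abs_convergent_prod)
  then have "(\<lambda>N. \<Prod>n\<le>N. 1 - z / complex_of_real (a n)) \<longlonglongrightarrow> f z"
    unfolding f by (rule convergent_prod_LIMSEQ)
  then have "(\<lambda>N. \<Prod>n<Suc N. 1 - z / complex_of_real (a n)) \<longlonglongrightarrow> f z"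
    by (simp only: lessThan_Suc_atMost)
  then show ?thesis by (rule LIMSEQ_imp_Suc)
qed

text \<open>Factorwise, |1 - z/a| \<le> 1 + |z|/a \<le> exp (|z|/a). An exponent linear in
  \<open>cmod z\<close> is all that the counting argument asks of an upper bound.\<close>

lemma canonical_product_norm_le:
  fixes a :: "nat \<Rightarrow> real" and z :: complex
  assumes a: "\<And>n. 1 \<le> a n" "summable (\<lambda>n. 1 / a n)"
    and f: "\<And>z. f z = (\<Prod>n. 1 - z / complex_of_real (a n))"
  shows "cmod (f z) \<le> exp ((\<Sum>n. 1 / a n) * cmod z)"
proof (rule LIMSEQ_le_const2)
  show "(\<lambda>N. cmod (\<Prod>n<N. 1 - z / complex_of_real (a n))) \<longlonglongrightarrow> cmod (f z)"
    by (intro tendsto_norm canonical_product_tendsto[OF a f])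
  have "cmod (\<Prod>n<N. 1 - z / complex_of_real (a n)) \<le> exp ((\<Sum>n. 1 / a n) * cmod z)" for N
  proof -
    have "cmod (\<Prod>n<N. 1 - z / complex_of_real (a n)) = (\<Prod>n<N. cmod (1 - z / complex_of_real (a n)))"
      by (simp only: prod_norm)
    also have "\<dots> \<le> (\<Prod>n<N. exp (1 / a n * cmod z))"
    proof (rule prod_mono)
      fix n
      have "cmod (1 - z / complex_of_real (a n)) \<le> 1 + cmod (z / complex_of_real (a n))"
        using norm_triangle_ineq4[of 1 "z / complex_of_real (a n)"] by simp
      also have "cmod (z / complex_of_real (a n)) = 1 / a n * cmod z"
        using a(1)[of n] by (simp add: norm_divide)
      also have "1 + 1 / a n * cmod z \<le> exp (1 / a n * cmod z)" by (rule exp_ge_add_one_self)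
      finally show "0 \<le> cmod (1 - z / complex_of_real (a n)) \<and>
          cmod (1 - z / complex_of_real (a n)) \<le> exp (1 / a n * cmod z)" by simp
    qed
    also have "\<dots> = exp ((\<Sum>n<N. 1 / a n) * cmod z)" by (simp only: exp_sum finite_lessThan sum_distrib_right)
    also have "(\<Sum>n<N. 1 / a n) \<le> (\<Sum>n. 1 / a n)"
    proof (rule sum_le_suminf[OF a(2)])
      show "0 \<le> 1 / a n" for n using a(1)[of n] by simp
    qed simp
    then have "exp ((\<Sum>n<N. 1 / a n) * cmod z) \<le> exp ((\<Sum>n. 1 / a n) * cmod z)"
      by (simp add: mult_right_mono)
    finally show ?thesis .
  qed
  then show "\<exists>N0. \<forall>N\<ge>N0. cmod (\<Prod>n<N. 1 - z / complex_of_real (a n)) \<le> exp ((\<Sum>n. 1 / a n) * cmod z)"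
    by blast
qed

text \<open>Locally uniform limit of the partial products: on the unit disc about \<open>x\<close>
  the moduli of z / a n are dominated by a fixed multiple of the summable
  \<open>1 / a n\<close>.\<close>

lemma canonical_product_holomorphic:
  fixes a :: "nat \<Rightarrow> real"
  assumes a: "\<And>n. 1 \<le> a n" "summable (\<lambda>n. 1 / a n)"
    and f: "\<And>z. f z = (\<Prod>n. 1 - z / complex_of_real (a n))"
  shows "f holomorphic_on UNIV"
proof (rule holomorphic_uniform_sequence[where f = "\<lambda>N z. \<Prod>n<N. 1 - z / complex_of_real (a n)"])
  show "(\<lambda>z. \<Prod>n<N. 1 - z / complex_of_real (a n)) holomorphic_on UNIV" for N
    using a(1) by (intro holomorphic_intros) (metis not_one_le_zero of_real_eq_0_iff)
  fix x :: complex
  define R where "R = cmod x + 1"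
  have bound: "cmod (- z / complex_of_real (a n)) \<le> R * (1 / a n)" if "z \<in> cball x 1" for z n
  proof -
    have "cmod z \<le> R" using that norm_triangle_ineq2[of z x] by (simp add: R_def dist_norm norm_minus_commute)
    then show ?thesis using a(1)[of n] by (simp add: norm_divide divide_right_mono)
  qed
  have "uniformly_convergent_on (cball x 1) (\<lambda>N z. \<Sum>n<N. cmod (- z / complex_of_real (a n)))"
    by (rule Weierstrass_m_test'[OF _ summable_mult[OF a(2), of R]]) (use bound in simp)
  then have "uniformly_convergent_on (cball x 1) (\<lambda>N z. \<Prod>n<N. 1 + - z / complex_of_real (a n))"
    using a(1) by (intro uniformly_convergent_on_prod continuous_intros) (auto, metis not_one_le_zero)
  then obtain l where l: "uniform_limit (cball x 1) (\<lambda>N z. \<Prod>n<N. 1 + - z / complex_of_real (a n)) l sequentially"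
    unfolding uniformly_convergent_on_def by blast
  have "l z = f z" if "z \<in> cball x 1" for z
    using tendsto_uniform_limitI[OF l that] canonical_product_tendsto[OF a f, of z]
    by (intro LIMSEQ_unique) simp_all
  then have "uniform_limit (cball x 1) (\<lambda>N z. \<Prod>n<N. 1 + - z / complex_of_real (a n)) l sequentially \<longleftrightarrow>
      uniform_limit (cball x 1) (\<lambda>N z. \<Prod>n<N. 1 + - z / complex_of_real (a n)) f sequentially"
    by (intro uniform_limit_cong') auto
  then have "uniform_limit (cball x 1) (\<lambda>N z. \<Prod>n<N. 1 + - z / complex_of_real (a n)) f sequentially"
    using l by blast
  then show "\<exists>d>0. cball x d \<subseteq> UNIV \<and>
      uniform_limit (cball x d) (\<lambda>N z. \<Prod>n<N. 1 - z / complex_of_real (a n)) f sequentially"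
    by (intro exI[of _ 1]) simp
qed simp_all

text \<open>In particular the set is finite, so \<open>counting_fun\<close> is a true count, and a
  sum over the zeros below a threshold belongs to a partial product.\<close>

lemma initial_segment:
  fixes a :: "nat \<Rightarrow> real"
  assumes "incseq a" "\<not> bdd_above (range a)"
  shows "\<exists>N. {n. a n < t} = {..<N}"
proof -
  have ex: "\<exists>n. t \<le> a n"
    using assms(2) unfolding bdd_above_def by (metis linorder_le_cases rangeE)
  define N where "N = (LEAST n. t \<le> a n)"
  have "t \<le> a N" unfolding N_def using ex by (rule LeastI_ex)
  moreover have "a n < t" if "n < N" for n
    using not_less_Least[of n "\<lambda>n. t \<le> a n"] that by (simp add: N_def not_le)
  ultimately have "{n. a n < t} = {..<N}"
    using incseqD[OF assms(1)] by (auto simp: not_less[symmetric]) (meson le_less_trans not_le order_trans)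
  then show ?thesis by blast
qed

text \<open>Put \<open>s = 1 / c\<close> and \<open>\<sigma> = s powr (\<rho> - 1 / 2)\<close>.
  Since \<open>u powr (\<rho> - 1 / 2)\<close> is nonincreasing, \<open>u powr \<rho>\<close> is at
  least \<open>\<sigma> * sqrt u\<close> up to \<open>s\<close> and at most that beyond. The rate
  changes sign at the same point, so replacing the one by the other only lowers the integral. The
  main term becomes \<open>\<sigma> * \<mu> * \<kappa> * r powr \<rho>\<close>, with
  \<open>\<kappa>\<close> the limit of the primitive.\<close>

lemma canonical_product_lower_bound:
  fixes a :: "nat \<Rightarrow> real" and f :: "complex \<Rightarrow> complex"
  assumes a: "\<And>n. 1 \<le> a n" "incseq a" "\<not> bdd_above (range a)" "summable (\<lambda>n. 1 / a n)"
    and f: "\<And>z. f z = (\<Prod>n. 1 - z / complex_of_real (a n))"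
    and rho: "0 < \<rho>" "\<rho> \<le> 1 / 2"
    and density: "((\<lambda>r. real (counting_fun a r) / r powr \<rho>) \<longlongrightarrow> \<mu>) at_top" "0 < \<mu>"
    and phi: "0 < \<phi>" "\<phi> < pi / 2"
  shows "\<exists>\<eta>>0. \<exists>r0\<ge>1. \<forall>z. z \<notin> sector \<phi> \<longrightarrow> r0 \<le> cmod z \<longrightarrow> exp (\<eta> * cmod z powr \<rho>) \<le> cmod (f z)"
proof -
  define c where "c = cos \<phi>"
  have c: "0 < c" "c < 1"
    using phi cos_monotone_0_pi[of 0 \<phi>] by (auto simp: c_def intro!: cos_gt_zero)
  define s where "s = 1 / c"
  have s: "1 < s" using c by (simp add: s_def)
  obtain \<Psi> \<kappa> where \<Psi>: "\<And>u. 0 < u \<Longrightarrow> (\<Psi> has_real_derivative sqrt u * log_kernel_rate c u) (at u)"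
    "(\<Psi> \<longlongrightarrow> 0) (at_right 0)" "(\<Psi> \<longlongrightarrow> \<kappa>) at_top" and \<kappa>: "0 < \<kappa>"
    using log_kernel_sqrt_primitive[OF c] by blast
  define \<sigma> where "\<sigma> = s powr (\<rho> - 1 / 2)"
  have \<sigma>: "0 < \<sigma>" using s by (simp add: \<sigma>_def)
  \<comment> \<open>The density is \<open>\<mu> - \<epsilon>\<close> where a lower bound is used and
    \<open>\<mu> + \<epsilon>\<close> where an upper one is, which leaves a mismatch
    \<open>2 * \<epsilon> * \<Psi> s\<close>. The second entry of the minimum keeps it below
    \<open>\<mu> * \<kappa> / 8\<close>, the first keeps \<open>\<mu> - \<epsilon>\<close>
    positive.\<close>
  define \<epsilon> where "\<epsilon> = min (\<mu> / 2) (\<mu> * \<kappa> / (16 * (\<bar>\<Psi> s\<bar> + 1)))"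
  have "0 < \<epsilon>" using density(2) \<kappa> by (simp add: \<epsilon>_def add_nonneg_pos)
  moreover have "\<epsilon> \<le> \<mu> / 2" unfolding \<epsilon>_def by (rule min.cobounded1)
  ultimately have \<epsilon>: "0 < \<epsilon>" "\<epsilon> \<le> \<mu> / 2" by auto
  have \<epsilon>\<Psi>: "2 * \<epsilon> * \<Psi> s \<le> \<mu> * \<kappa> / 8"
  proof -
    have "\<epsilon> * (16 * (\<bar>\<Psi> s\<bar> + 1)) \<le> \<mu> * \<kappa>"
      by (subst pos_le_divide_eq[symmetric]) (auto simp: \<epsilon>_def)
    then have "16 * (\<epsilon> * (\<bar>\<Psi> s\<bar> + 1)) \<le> \<mu> * \<kappa>" by (simp only: mult.left_commute)
    moreover have "\<epsilon> * \<Psi> s \<le> \<epsilon> * (\<bar>\<Psi> s\<bar> + 1)" using \<epsilon>(1) by (intro mult_left_mono) auto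
    ultimately show ?thesis unfolding mult.assoc by linarith
  qed
  \<comment> \<open>Of the main term \<open>\<sigma> * \<mu> * \<kappa>\<close> four eighths are
    given away: one each to \<open>\<Psi> u0\<close>, to the mismatch
    \<open>\<epsilon>\<Psi>\<close>, to the tail of \<open>\<Psi>\<close> beyond \<open>x\<close>
    and to the boundary term at \<open>x\<close>.\<close>
  define \<eta> where "\<eta> = \<sigma> * \<mu> * \<kappa> / 2"
  have \<eta>: "0 < \<eta>" using \<sigma> \<kappa> density(2) by (simp add: \<eta>_def)
  have "\<forall>\<^sub>F t in at_top. dist (real (counting_fun a t) / t powr \<rho>) \<mu> < \<epsilon>"
    using density(1) \<epsilon>(1) by (rule tendstoD)
  then obtain t1 where t1: "\<And>t. t1 \<le> t \<Longrightarrow> dist (real (counting_fun a t) / t powr \<rho>) \<mu> < \<epsilon>"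
    unfolding eventually_at_top_linorder by blast
  define t0 where "t0 = max 1 t1"
  have t0: "1 \<le> t0" by (simp add: t0_def)
  have count: "(\<mu> - \<epsilon>) * t powr \<rho> \<le> real (counting_fun a t)"
      "real (counting_fun a t) \<le> (\<mu> + \<epsilon>) * t powr \<rho>" if "t0 \<le> t" for t
  proof -
    have "0 < t powr \<rho>" using that t0 by simp
    moreover have "\<mu> - \<epsilon> \<le> real (counting_fun a t) / t powr \<rho>" "real (counting_fun a t) / t powr \<rho> \<le> \<mu> + \<epsilon>"
      using t1[of t] that by (auto simp: dist_real_def t0_def abs_less_iff)
    ultimately show "(\<mu> - \<epsilon>) * t powr \<rho> \<le> real (counting_fun a t)"
      "real (counting_fun a t) \<le> (\<mu> + \<epsilon>) * t powr \<rho>"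
      by (simp_all only: pos_le_divide_eq pos_divide_le_eq)
  qed
  have "\<forall>\<^sub>F u in at_right 0. \<Psi> u < \<kappa> / 8" using \<Psi>(2) \<kappa> by (intro order_tendstoD(2)) auto
  then obtain \<delta> where \<delta>: "0 < \<delta>" "\<And>u. 0 < u \<Longrightarrow> u < \<delta> \<Longrightarrow> \<Psi> u < \<kappa> / 8"
    unfolding eventually_at_right_field by blast
  \<comment> \<open>\<open>log_kernel c x\<close> behaves like \<open>- c / x\<close>, while the
    number of zeros below \<open>r * x\<close> is at most a multiple of
    \<open>r powr \<rho> * sqrt x\<close>. So the boundary term is small compared with
    \<open>r powr \<rho>\<close>.\<close>
  have "((\<lambda>x. sqrt x * log_kernel c x) \<longlongrightarrow> 0) at_top"
    unfolding log_kernel_def using c by real_asymp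
  then have "((\<lambda>x. (\<mu> + \<epsilon>) * (sqrt x * log_kernel c x)) \<longlongrightarrow> (\<mu> + \<epsilon>) * 0) at_top"
    by (rule tendsto_mult_left)
  then have "\<forall>\<^sub>F x in at_top. - (\<sigma> * \<mu> * \<kappa> / 8) < (\<mu> + \<epsilon>) * (sqrt x * log_kernel c x)"
    using \<sigma> \<kappa> density(2) by (intro order_tendstoD(1)) auto
  moreover have "\<forall>\<^sub>F x in at_top. 7 * \<kappa> / 8 < \<Psi> x"
    using \<Psi>(3) \<kappa> by (intro order_tendstoD(1)) auto
  ultimately have "\<forall>\<^sub>F x in at_top. - (\<sigma> * \<mu> * \<kappa> / 8) < (\<mu> + \<epsilon>) * (sqrt x * log_kernel c x) \<and> 7 * \<kappa> / 8 < \<Psi> x"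
    by (rule eventually_conj)
  then obtain x1 where x1: "\<And>x. x1 \<le> x \<Longrightarrow>
      - (\<sigma> * \<mu> * \<kappa> / 8) < (\<mu> + \<epsilon>) * (sqrt x * log_kernel c x) \<and> 7 * \<kappa> / 8 < \<Psi> x"
    unfolding eventually_at_top_linorder by blast
  \<comment> \<open>The counting estimates hold from \<open>u = t0 / r\<close> on; for
    \<open>r \<ge> r0\<close> this cut lies below \<open>\<delta>\<close>, where
    \<open>\<Psi>\<close> is less than \<open>\<kappa> / 8\<close>.\<close>
  define r0 where "r0 = max t0 (2 * t0 / \<delta>)"
  have r0: "1 \<le> r0" using t0 by (simp add: r0_def)
  \<comment> \<open>The bound does not depend on the truncation \<open>x\<close>, and the threshold
    for \<open>x\<close> does not depend on \<open>r\<close>; this permits the passage to the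
    infinite product.\<close>
  have main: "\<eta> * r powr \<rho> \<le> (\<Sum>n\<in>{n. a n < r * x}. log_kernel c (a n / r))"
    if r: "r0 \<le> r" and x: "max s x1 \<le> x" for r x
  proof -
    have "t0 \<le> r0" unfolding r0_def by (rule max.cobounded1)
    then have r1: "1 \<le> r" "t0 \<le> r" using r r0 by linarith+
    have x': "s \<le> x" "x1 \<le> x" "1 \<le> x" using x s by auto
    define A where "A = {n. a n < r * x}"
    obtain N where "A = {..<N}" using initial_segment[OF a(2,3), of "r * x"] unfolding A_def by blast
    then have A: "finite A" by simp
    define u0 where "u0 = t0 / r"
    have u0: "0 < u0" "1 / r \<le> u0" "u0 \<le> s" "u0 < \<delta>"
    proof -
      show "0 < u0" unfolding u0_def using r1 t0 by (intro divide_pos_pos) linarith+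
      show "1 / r \<le> u0" unfolding u0_def using r1 t0 by (intro divide_right_mono) linarith+
      have "u0 \<le> 1" using r1 by (simp add: u0_def)
      then show "u0 \<le> s" using s by simp
      have "2 * t0 / \<delta> \<le> r0" unfolding r0_def by (rule max.cobounded2)
      then have "2 * t0 / \<delta> \<le> r" using r by linarith
      then have "2 * t0 \<le> r * \<delta>" using \<delta>(1) by (simp only: pos_divide_le_eq)
      then have "t0 < \<delta> * r" unfolding mult.commute[of r] using t0 by linarith
      then show "u0 < \<delta>" using r1 unfolding u0_def by (subst pos_divide_less_eq) auto
    qed
    have set_eq: "card {n\<in>A. a n / r < u} = counting_fun a (r * u)" if "u \<le> x" for u
    proof -
      have "r * u \<le> r * x" using that r1 by (intro mult_left_mono) auto
      moreover have "a n / r < u \<longleftrightarrow> a n < r * u" for n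
        using r1 by (simp add: pos_divide_less_eq mult.commute)
      ultimately have "{n\<in>A. a n / r < u} = {n. a n < r * u}" by (auto simp: A_def)
      then show ?thesis by (simp add: counting_fun_def)
    qed
    have split: "(r * u) powr \<rho> = r powr \<rho> * (u powr (\<rho> - 1 / 2) * sqrt u)" if "0 < u" for u
      using that r1 by (simp add: powr_mult powr_half_sqrt[symmetric] powr_add[symmetric])
    define p where "p = (\<mu> - \<epsilon>) * r powr \<rho> * \<sigma>"
    define q where "q = (\<mu> + \<epsilon>) * r powr \<rho> * \<sigma>"
    have \<mu>\<epsilon>: "0 \<le> \<mu> - \<epsilon>" "0 \<le> \<mu> + \<epsilon>" using \<epsilon> density(2) by auto
    have "card A * log_kernel c x + p * (\<Psi> (1 / c) - \<Psi> u0) + q * (\<Psi> x - \<Psi> (1 / c))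
        \<le> (\<Sum>n\<in>A. log_kernel c (a n / r))"
    proof (rule sum_log_kernel_lower[OF c A])
      show "0 < 1 / r" "1 / r \<le> u0" "u0 \<le> 1 / c" "1 / c \<le> x"
        using r1 u0 x' by (auto simp: s_def)
      show "1 / r \<le> a n / r \<and> a n / r \<le> x" if "n \<in> A" for n
        using that r1 a(1)[of n] by (auto simp: A_def divide_right_mono pos_divide_le_eq mult.commute)
      fix u
      {
        assume u: "u0 \<le> u" "u \<le> 1 / c"
        then have upos: "0 < u" and us: "u \<le> s" and "u \<le> x" using u0 x' by (auto simp: s_def)
        have "r * u0 \<le> r * u" using u r1 by (intro mult_left_mono) auto
        then have "t0 \<le> r * u" using r1 by (simp add: u0_def)
        then have "(\<mu> - \<epsilon>) * (r * u) powr \<rho> \<le> real (card {n\<in>A. a n / r < u})"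
          using count(1) set_eq[OF \<open>u \<le> x\<close>] by simp
        moreover have "\<sigma> \<le> u powr (\<rho> - 1 / 2)"
          unfolding \<sigma>_def using rho upos us by (intro powr_mono2') auto
        then have "(\<mu> - \<epsilon>) * (r powr \<rho> * (\<sigma> * sqrt u)) \<le> (\<mu> - \<epsilon>) * (r powr \<rho> * (u powr (\<rho> - 1 / 2) * sqrt u))"
          using \<mu>\<epsilon> upos by (intro mult_left_mono mult_right_mono) auto
        ultimately show "p * sqrt u \<le> real (card {n\<in>A. a n / r < u})"
          unfolding p_def split[OF upos] by (simp only: mult.assoc)
      next
        assume u: "1 / c \<le> u" "u \<le> x"
        then have us: "s \<le> u" by (simp add: s_def)
        then have upos: "0 < u" and u1: "1 \<le> u" using s by auto
        have "r * 1 \<le> r * u" using u1 r1 by (intro mult_left_mono) auto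
        then have "t0 \<le> r * u" using r1 by linarith
        then have "real (card {n\<in>A. a n / r < u}) \<le> (\<mu> + \<epsilon>) * (r * u) powr \<rho>"
          using count(2) set_eq[OF u(2)] by simp
        moreover have "u powr (\<rho> - 1 / 2) \<le> \<sigma>"
          unfolding \<sigma>_def using rho s us by (intro powr_mono2') auto
        then have "(\<mu> + \<epsilon>) * (r powr \<rho> * (u powr (\<rho> - 1 / 2) * sqrt u)) \<le> (\<mu> + \<epsilon>) * (r powr \<rho> * (\<sigma> * sqrt u))"
          using \<mu>\<epsilon> upos by (intro mult_left_mono mult_right_mono) auto
        ultimately show "real (card {n\<in>A. a n / r < u}) \<le> q * sqrt u"
          unfolding q_def split[OF upos] by (simp only: mult.assoc)
      }
    qed (rule \<Psi>(1))
    moreover have "r powr \<rho> * (- (\<sigma> * \<mu> * \<kappa> / 8)) \<le> card A * log_kernel c x"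
    proof (cases "0 \<le> log_kernel c x")
      case True
      have "r powr \<rho> * (- (\<sigma> * \<mu> * \<kappa> / 8)) \<le> 0"
        using \<sigma> \<kappa> density(2) by (intro mult_nonneg_nonpos) auto
      then show ?thesis using True by (meson mult_nonneg_nonneg of_nat_0_le_iff order_trans)
    next
      case False
      have "r * 1 \<le> r * x" using x' r1 by (intro mult_left_mono) auto
      then have "t0 \<le> r * x" using r1 by linarith
      then have "real (card A) \<le> (\<mu> + \<epsilon>) * (r * x) powr \<rho>"
        using count(2)[of "r * x"] by (simp only: A_def counting_fun_def)
      also have "\<dots> = (\<mu> + \<epsilon>) * (r powr \<rho> * x powr \<rho>)" using r1 x' by (simp add: powr_mult)
      also have "\<dots> \<le> (\<mu> + \<epsilon>) * (r powr \<rho> * sqrt x)"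
        using \<mu>\<epsilon> rho x' powr_mono[of \<rho> "1/2" x]
        by (intro mult_left_mono) (auto simp: powr_half_sqrt[symmetric])
      finally have "(\<mu> + \<epsilon>) * (r powr \<rho> * sqrt x) * log_kernel c x \<le> card A * log_kernel c x"
        using False by (intro mult_right_mono_neg) auto
      moreover have "r powr \<rho> * (- (\<sigma> * \<mu> * \<kappa> / 8)) \<le> r powr \<rho> * ((\<mu> + \<epsilon>) * (sqrt x * log_kernel c x))"
        using x1[OF x'(2)] by (intro mult_left_mono) auto
      ultimately show ?thesis by (simp only: mult_ac)
    qed
    moreover have "r powr \<rho> * (\<sigma> * (5 * \<mu> * \<kappa> / 8)) \<le> p * (\<Psi> (1 / c) - \<Psi> u0) + q * (\<Psi> x - \<Psi> (1 / c))"
    proof -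
      have "(\<mu> - \<epsilon>) * \<Psi> u0 \<le> (\<mu> - \<epsilon>) * (\<kappa> / 8)"
        using \<mu>\<epsilon> \<delta>(2)[OF u0(1,4)] by (intro mult_left_mono) auto
      also have "\<dots> \<le> \<mu> * (\<kappa> / 8)" using \<epsilon> \<kappa> by (intro mult_right_mono) auto
      finally have 1: "(\<mu> - \<epsilon>) * \<Psi> u0 \<le> \<mu> * (\<kappa> / 8)" .
      have "\<mu> * (7 * \<kappa> / 8) \<le> (\<mu> + \<epsilon>) * \<Psi> x"
        using x1[OF x'(2)] \<epsilon> \<kappa> density(2) by (intro mult_mono) auto
      then have "5 * \<mu> * \<kappa> / 8 \<le> (\<mu> - \<epsilon>) * (\<Psi> s - \<Psi> u0) + (\<mu> + \<epsilon>) * (\<Psi> x - \<Psi> s)"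
        using 1 \<epsilon>\<Psi> by (simp add: algebra_simps)
      then have "r powr \<rho> * (\<sigma> * (5 * \<mu> * \<kappa> / 8)) \<le>
          r powr \<rho> * (\<sigma> * ((\<mu> - \<epsilon>) * (\<Psi> s - \<Psi> u0) + (\<mu> + \<epsilon>) * (\<Psi> x - \<Psi> s)))"
        using \<sigma> by (intro mult_left_mono) auto
      also have "\<dots> = p * (\<Psi> s - \<Psi> u0) + q * (\<Psi> x - \<Psi> s)"
        unfolding p_def q_def by (simp only: distrib_left mult_ac)
      finally show ?thesis unfolding s_def .
    qed
    moreover have "\<eta> * r powr \<rho> = r powr \<rho> * (- (\<sigma> * \<mu> * \<kappa> / 8)) + r powr \<rho> * (\<sigma> * (5 * \<mu> * \<kappa> / 8))"
      by (simp add: \<eta>_def algebra_simps)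
    ultimately show ?thesis unfolding A_def by linarith
  qed
  have "exp (\<eta> * cmod z powr \<rho>) \<le> cmod (f z)" if z: "z \<notin> sector \<phi>" "r0 \<le> cmod z" for z
  proof (rule ccontr)
    assume "\<not> ?thesis"
    then have "cmod (f z) < exp (\<eta> * cmod z powr \<rho>)" by simp
    moreover have "(\<lambda>N. cmod (\<Prod>n<N. 1 - z / complex_of_real (a n))) \<longlonglongrightarrow> cmod (f z)"
      by (intro tendsto_norm canonical_product_tendsto[OF a(1,4) f])
    ultimately have "\<forall>\<^sub>F N in sequentially. cmod (\<Prod>n<N. 1 - z / complex_of_real (a n)) < exp (\<eta> * cmod z powr \<rho>)"
      by (intro order_tendstoD(2))
    then obtain M where M: "\<And>N. M \<le> N \<Longrightarrow> cmod (\<Prod>n<N. 1 - z / complex_of_real (a n)) < exp (\<eta> * cmod z powr \<rho>)"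
      unfolding eventually_sequentially by blast
    define r where "r = cmod z"
    have r: "r0 \<le> r" "0 < r" using z(2) r0 by (auto simp: r_def)
    \<comment> \<open>The bound \<open>main\<close> covers only the partial products cut at a
      threshold \<open>r * x\<close>. The last entry moves this cut past the index \<open>M\<close>,
      from which on the partial products would be too small.\<close>
    define x where "x = max (max s x1) ((a M + 1) / r)"
    have x: "max s x1 \<le> x" by (simp add: x_def)
    have "(a M + 1) / r \<le> x" by (simp add: x_def)
    then have "a M < r * x" using r(2) by (simp add: pos_divide_le_eq mult.commute)
    obtain N where N: "{n. a n < r * x} = {..<N}" using initial_segment[OF a(2,3)] by blast
    then have "M < N" using \<open>a M < r * x\<close> by auto
    have "exp (\<eta> * r powr \<rho>) \<le> exp (\<Sum>n<N. log_kernel c (a n / r))"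
      using main[OF r(1) x] unfolding N by simp
    also have "\<dots> = (\<Prod>n<N. exp (log_kernel c (a n / r)))" by (simp add: exp_sum)
    also have "\<dots> \<le> (\<Prod>n<N. cmod (1 - z / complex_of_real (a n)))"
    proof (rule prod_mono)
      fix n
      have "0 < a n" using a(1)[of n] by simp
      then show "0 \<le> exp (log_kernel c (a n / r)) \<and> exp (log_kernel c (a n / r)) \<le> cmod (1 - z / complex_of_real (a n))"
        unfolding r_def using norm_one_minus_ge_exp_log_kernel[OF c] Re_le_of_notin_sector[OF phi z(1)]
        by (simp add: c_def)
    qed
    also have "\<dots> = cmod (\<Prod>n<N. 1 - z / complex_of_real (a n))" by (simp only: prod_norm)
    also have "\<dots> < exp (\<eta> * r powr \<rho>)" unfolding r_def using M[of N] \<open>M < N\<close> by simp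
    finally show False by simp
  qed
  then show ?thesis using \<eta> r0 by blast
qed

section \<open>Counting algebraic points\<close>

lemma bival_holomorphic:
  assumes "f holomorphic_on UNIV"
  shows "(\<lambda>z. bival T c z (f z)) holomorphic_on UNIV"
  unfolding bival_def using assms by (intro holomorphic_intros)

text \<open>Everything is put on the exponential scale, using (T + 1)^2 \<le> exp (2 T) and h \<le>
  exp u. The radius \<open>9 * R\<close> is the one at which \<open>norm_le_of_zeros\<close> asks
  for a bound; the second estimate concerns the size of the coefficients.\<close>

lemma bival_norm_le_exp:
  fixes T h :: nat and u R S :: real
  assumes c: "\<And>i j. i \<le> T \<Longrightarrow> j \<le> T \<Longrightarrow> \<bar>c i j\<bar> \<le> int ((T + 1)\<^sup>2 * h ^ (2 * T))"
    and h: "1 \<le> h" "ln h \<le> u" and R: "1 \<le> R" and S: "0 \<le> S"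
    and z: "cmod z = 9 * R" "cmod w \<le> exp (S * cmod z)"
  shows "cmod (bival T c z w) \<le> exp (T * (4 + 2 * u + 9 * R * (1 + S)))"
    "real ((T + 1)\<^sup>2 * h ^ (2 * T)) \<le> exp (2 * T * (1 + u))"
proof -
  have T2: "(real T + 1)\<^sup>2 \<le> exp (2 * real T)"
  proof -
    have "(real T + 1)\<^sup>2 \<le> (exp (real T))\<^sup>2"
      using exp_ge_add_one_self[of "real T"] by (intro power_mono) linarith+
    then show ?thesis by (simp only: exp_double)
  qed
  have "real h = exp (ln (real h))" using h(1) by simp
  also have "\<dots> \<le> exp u" using h(2) by simp
  finally have "real h \<le> exp u" .
  then have "real h ^ (2 * T) \<le> exp u ^ (2 * T)" by (intro power_mono) auto
  also have "\<dots> = exp (real (2 * T) * u)" by (rule exp_of_nat_mult[symmetric])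
  finally have hT: "real h ^ (2 * T) \<le> exp (real (2 * T) * u)" .
  have "real ((T + 1)\<^sup>2 * h ^ (2 * T)) = (real T + 1)\<^sup>2 * real h ^ (2 * T)"
    by (simp only: of_nat_mult semiring_1_class.of_nat_power of_nat_add of_nat_1)
  also have "\<dots> \<le> exp (2 * real T) * exp (real (2 * T) * u)"
    using T2 hT by (intro mult_mono) auto
  also have "\<dots> = exp (2 * T * (1 + u))"
    by (simp add: exp_add[symmetric] algebra_simps)
  finally show L: "real ((T + 1)\<^sup>2 * h ^ (2 * T)) \<le> exp (2 * T * (1 + u))" .
  have "cmod (bival T c z w) \<le> real (T + 1) ^ 2 * real ((T + 1)\<^sup>2 * h ^ (2 * T)) * ((9 * R) ^ T * exp (S * (9 * R)) ^ T)"
  proof (rule bival_norm_le)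
    show "real_of_int \<bar>c i j\<bar> \<le> real ((T + 1)\<^sup>2 * h ^ (2 * T))" if "i \<le> T" "j \<le> T" for i j
      using c[OF that] by linarith
  qed (use z R S in auto)
  also have "\<dots> \<le> exp (2 * real T) * exp (2 * T * (1 + u)) * (exp (real T * (9 * R)) * exp (real T * (S * (9 * R))))"
  proof (intro mult_mono)
    show "real (T + 1) ^ 2 \<le> exp (2 * real T)" using T2 by (simp add: add.commute)
    have "(9 * R) ^ T \<le> exp (9 * R) ^ T"
      using exp_ge_add_one_self[of "9 * R"] R by (intro power_mono) linarith+
    then show "(9 * R) ^ T \<le> exp (real T * (9 * R))" by (simp only: exp_of_nat_mult)
    show "exp (S * (9 * R)) ^ T \<le> exp (real T * (S * (9 * R)))" by (simp only: exp_of_nat_mult order_refl)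
  qed (use L R in auto)
  also have "\<dots> = exp (2 * real T + 2 * T * (1 + u) + (real T * (9 * R) + real T * (S * (9 * R))))"
    by (simp only: exp_add)
  also have "2 * real T + 2 * T * (1 + u) + (real T * (9 * R) + real T * (S * (9 * R))) = T * (4 + 2 * u + 9 * R * (1 + S))"
    by (simp add: algebra_simps)
  finally show "cmod (bival T c z w) \<le> exp (T * (4 + 2 * u + 9 * R * (1 + S)))" .
qed

lemma exp_le_4_power: "exp (real n) \<le> 4 ^ n"
proof -
  have "exp (real n) = exp 1 ^ n" using exp_of_nat_mult[of n "1::real"] by simp
  also have "\<dots> \<le> 4 ^ n" using exp_le by (intro power_mono) auto
  finally show ?thesis .
qed

text \<open>The pigeonhole principle is applied to a subset \<open>Z\<close> of exactly N = (T + 1)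
  M points, so \<open>T\<close> does not depend on \<open>card F\<close>. At any other point of
  \<open>F\<close> the Schwarz lemma bounds the value by exp (O (T u)) / 4^N, whereas a nonzero
  value would be at least exp (- O (T u)). The lower bound for \<open>M\<close> collects the implied
  constants, and N > T M gives the contradiction.\<close>

lemma exists_bival_vanishing_everywhere:
  fixes f :: "complex \<Rightarrow> complex" and d h M T :: nat and u S :: real
  assumes f: "f holomorphic_on UNIV" "\<And>z. cmod (f z) \<le> exp (S * cmod z)" and S: "0 \<le> S"
    and h: "1 \<le> h" "ln h \<le> u" and u: "1 \<le> u"
    and M: "1 \<le> M" "(6 + 9 * (1 + S) + 8 * (d\<^sup>2 + 1)) * u \<le> M" and T: "T + 1 = 4 * (d\<^sup>2 + 3) * M"
    and F: "finite F" "\<And>z. z \<in> F \<Longrightarrow> cmod z \<le> u" "\<And>z. z \<in> F \<Longrightarrow> int_algebraic d h z"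
      "\<And>z. z \<in> F \<Longrightarrow> int_algebraic d h (f z)"
    and card: "4 * (d\<^sup>2 + 3) * M\<^sup>2 \<le> card F"
  shows "\<exists>c. (\<forall>i\<le>T. \<forall>j\<le>T. \<bar>c i j\<bar> \<le> int ((T + 1)\<^sup>2 * h ^ (2 * T))) \<and>
    (\<exists>i\<le>T. \<exists>j\<le>T. c i j \<noteq> 0) \<and> (\<forall>z\<in>F. bival T c z (f z) = 0)"
proof -
  define N where "N = 4 * (d\<^sup>2 + 3) * M\<^sup>2"
  have NT: "N = (T + 1) * M" unfolding N_def T by (simp only: power2_eq_square mult.assoc)
  have "1 * 1 \<le> (d\<^sup>2 + 3) * M" using M(1) by (intro mult_le_mono) auto
  then have T1: "1 \<le> T" using T by linarith
  obtain Z where Z: "Z \<subseteq> F" "card Z = N" "finite Z"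
    using obtain_subset_with_card_n[OF card] unfolding N_def by blast
  \<comment> \<open>An equality: the choice of \<open>T\<close> spends the coefficients
    exactly.\<close>
  have Zle: "4 * card Z * (d\<^sup>2 + 3) \<le> (T + 1)\<^sup>2"
  proof -
    have "4 * (4 * k * M\<^sup>2) * k = (4 * k * M)\<^sup>2" for k by (simp add: power2_eq_square)
    from this[of "d\<^sup>2 + 3"] show ?thesis unfolding Z(2) N_def T by (simp only: order_refl)
  qed
  have "\<exists>c. (\<forall>i\<le>T. \<forall>j\<le>T. \<bar>c i j\<bar> \<le> int ((T + 1)\<^sup>2 * h ^ (2 * T))) \<and> (\<exists>i\<le>T. \<exists>j\<le>T. c i j \<noteq> 0) \<and>
             (\<forall>z\<in>Z. bival T c z (f z) = 0)"
    by (rule exists_bival_vanishing[OF Z(3) _ _ h(1) T1 Zle]) (use F Z in auto)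
  then obtain c where c: "\<And>i j. i \<le> T \<Longrightarrow> j \<le> T \<Longrightarrow> \<bar>c i j\<bar> \<le> int ((T + 1)\<^sup>2 * h ^ (2 * T))"
    "\<exists>i\<le>T. \<exists>j\<le>T. c i j \<noteq> 0" and cZ: "\<And>z. z \<in> Z \<Longrightarrow> bival T c z (f z) = 0"
    by blast
  have "bival T c z (f z) = 0" if z: "z \<in> F" for z
  proof (rule ccontr)
    assume nz: "bival T c z (f z) \<noteq> 0"
    define L where "L = real ((T + 1)\<^sup>2 * h ^ (2 * T))"
    have "0 < (T + 1)\<^sup>2 * h ^ (2 * T)" using h(1) by simp
    then have L1: "1 \<le> L" unfolding L_def by (metis One_nat_def Suc_leI of_nat_1 of_nat_le_iff)
    \<comment> \<open>Only the estimate for the coefficients is wanted, so \<open>R\<close>,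
      \<open>S\<close>, \<open>z\<close> and \<open>w\<close> receive arbitrary admissible
      values.\<close>
    have Lexp: "L \<le> exp (2 * T * (1 + u))"
      unfolding L_def using h u S c(1)
      by (intro bival_norm_le_exp(2)[where R = 1 and S = 0 and z = 9 and w = 0 and c = c]) auto
    have "(real (T + 1))\<^sup>2 * L * real h ^ (2 * T) = L ^ 2"
    proof -
      have "L = (real (T + 1))\<^sup>2 * real h ^ (2 * T)" 
        by (simp only: L_def of_nat_mult semiring_1_class.of_nat_power)
      then show ?thesis by (simp only: power2_eq_square mult_ac)
    qed
    moreover have "1 \<le> cmod (bival T c z (f z)) * ((real (T + 1))\<^sup>2 * L * real h ^ (2 * T)) ^ (d\<^sup>2 + 1)"
    proof (rule bival_lower_bound[OF F(3,4)[OF z] _ L1 nz])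
      show "real_of_int \<bar>c i j\<bar> \<le> L" if "i \<le> T" "j \<le> T" for i j
        unfolding L_def using c(1)[OF that] by linarith
    qed
    ultimately have low: "1 \<le> cmod (bival T c z (f z)) * L ^ (2 * (d\<^sup>2 + 1))"
      by (simp only: power_mult)
    have "cmod (bival T c z (f z)) * 4 ^ card Z \<le> exp (T * (4 + 2 * u + 9 * u * (1 + S)))"
    proof (rule norm_le_of_zeros[where g = "\<lambda>z. bival T c z (f z)" and R = u])
      show "Z \<subseteq> cball 0 u" using Z F(2) by auto
      show "(\<lambda>z. bival T c z (f z)) holomorphic_on UNIV" by (rule bival_holomorphic[OF f(1)])
      show "cmod (bival T c y (f y)) \<le> exp (T * (4 + 2 * u + 9 * u * (1 + S)))" if "cmod y = 9 * u" for y
        by (rule bival_norm_le_exp(1)[OF c(1) h u S that f(2)])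
    qed (use Z cZ u F(2)[OF z] in auto)
    then have up: "cmod (bival T c z (f z)) * 4 ^ N \<le> exp (T * (4 + 2 * u + 9 * u * (1 + S)))"
      using Z(2) by simp
    have "exp (real N) \<le> 4 ^ N" by (rule exp_le_4_power)
    also have "\<dots> \<le> 4 ^ N * (cmod (bival T c z (f z)) * L ^ (2 * (d\<^sup>2 + 1)))"
      using mult_left_mono[OF low, of "4 ^ N"] by simp
    also have "\<dots> = cmod (bival T c z (f z)) * 4 ^ N * L ^ (2 * (d\<^sup>2 + 1))" by (simp only: mult_ac)
    also have "\<dots> \<le> exp (T * (4 + 2 * u + 9 * u * (1 + S))) * exp (2 * T * (1 + u)) ^ (2 * (d\<^sup>2 + 1))"
      using up Lexp L1 by (intro mult_mono power_mono) auto
    also have "\<dots> = exp (T * (4 + 2 * u + 9 * u * (1 + S)) + real (2 * (d\<^sup>2 + 1)) * (2 * T * (1 + u)))"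
      by (simp only: exp_add exp_of_nat_mult)
    finally have "real N \<le> T * (4 + 2 * u + 9 * u * (1 + S)) + real (2 * (d\<^sup>2 + 1)) * (2 * T * (1 + u))"
      by (simp only: exp_le_cancel_iff)
    also have "\<dots> = T * (4 + 2 * u + 9 * u * (1 + S) + 4 * (real d ^ 2 + 1) * (1 + u))"
      by (simp add: algebra_simps)
    also have "\<dots> \<le> T * ((6 + 9 * (1 + S) + 8 * (real d ^ 2 + 1)) * u)"
    proof (rule mult_left_mono)
      have "4 * (real d ^ 2 + 1) * (1 + u) \<le> 4 * (real d ^ 2 + 1) * (2 * u)"
        using u by (intro mult_left_mono) auto
      then show "4 + 2 * u + 9 * u * (1 + S) + 4 * (real d ^ 2 + 1) * (1 + u) \<le> (6 + 9 * (1 + S) + 8 * (real d ^ 2 + 1)) * u"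
        using u by (simp add: algebra_simps)
    qed simp
    also have "\<dots> \<le> real T * real M" using M(2) by (intro mult_left_mono) auto
    also have "\<dots> < real N" using M(1) by (simp add: NT algebra_simps)
    finally show False by simp
  qed
  then show ?thesis using c by blast
qed

text \<open>Let \<open>J\<close> be the highest power of the second variable that occurs. Its
  coefficient polynomial has degree at most \<open>T\<close>, so one of \<open>T + 1\<close>
  consecutive negative integers is not a root, and there its value is a nonzero integer. The size of
  \<open>w m\<close> lets the term with \<open>J\<close> outweigh the lower ones by at least 1. Only
  the window containing \<open>m\<close> is known, so \<open>w\<close> has to be large for all
  \<open>m \<ge> m0\<close>.\<close>

lemma bival_nonvanishing:
  fixes T m0 :: nat and L :: real
  assumes c: "\<And>i j. i \<le> T \<Longrightarrow> j \<le> T \<Longrightarrow> real_of_int \<bar>c i j\<bar> \<le> L" "\<exists>i\<le>T. \<exists>j\<le>T. c i j \<noteq> 0"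
    and m0: "1 \<le> m0"
    and w: "\<And>m. m0 \<le> m \<Longrightarrow> (T + 1)\<^sup>2 * L * real m ^ T + 1 \<le> cmod (w m)"
  shows "\<exists>m\<ge>m0. m \<le> m0 + T \<and> 1 \<le> cmod (bival T c (- of_nat m) (w m))"
proof -
  have L: "0 \<le> L" using c(1)[of 0 0] by linarith
  define J where "J = Max {j. j \<le> T \<and> (\<exists>i\<le>T. c i j \<noteq> 0)}"
  have fin: "finite {j. j \<le> T \<and> (\<exists>i\<le>T. c i j \<noteq> 0)}" by (rule finite_subset[of _ "{..T}"]) auto
  have "J \<in> {j. j \<le> T \<and> (\<exists>i\<le>T. c i j \<noteq> 0)}"
    unfolding J_def using c(2) by (intro Max_in[OF fin]) blast
  then obtain i0 where J: "J \<le> T" "i0 \<le> T" "c i0 J \<noteq> 0" by blast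
  have Jmax: "c i j = 0" if "i \<le> T" "j \<le> T" "J < j" for i j
    using Max_ge[OF fin, of j] that unfolding J_def[symmetric] by (metis (mono_tags, lifting) mem_Collect_eq not_less)
  define p where "p = (\<Sum>i\<le>T. Polynomial.monom (c i J) i)"
  have cp: "Polynomial.coeff p i = (if i \<le> T then c i J else 0)" for i
    by (simp add: p_def Polynomial.coeff_sum coeff_monom)
  have p0: "p \<noteq> 0" using cp[of i0] J by auto
  have dp: "Polynomial.degree p \<le> T" by (rule Polynomial.degree_le) (simp add: cp)
  have pev: "poly p x = (\<Sum>i\<le>T. c i J * x ^ i)" for x
    by (simp add: p_def poly_sum poly_monom)
  have "\<exists>m\<in>{m0..m0+T}. poly p (- int m) \<noteq> 0"
  proof (rule ccontr)
    assume "\<not> ?thesis"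
    then have "(\<lambda>m. - int m) ` {m0..m0+T} \<subseteq> {x. poly p x = 0}" by auto
    then have "card ((\<lambda>m. - int m) ` {m0..m0+T}) \<le> card {x. poly p x = 0}"
      by (intro card_mono poly_roots_finite[OF p0])
    also have "\<dots> \<le> T" using card_poly_roots_bound[OF p0] dp by simp
    also have "card ((\<lambda>m. - int m) ` {m0..m0+T}) = T + 1"
      by (subst card_image) (auto simp: inj_on_def)
    finally show False by simp
  qed
  then obtain m where m: "m0 \<le> m" "m \<le> m0 + T" "poly p (- int m) \<noteq> 0" by auto
  let ?x = "- of_nat m :: complex"
  define P where "P j = (\<Sum>i\<le>T. of_int (c i j) * ?x ^ i)" for j
  have PJ: "1 \<le> cmod (P J)"
  proof -
    have "P J = of_int (poly p (- int m))" by (simp add: P_def pev)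
    then show ?thesis using m(3) by (simp add: norm_of_int)
  qed
  have m1: "1 \<le> real m" using m(1) m0 by simp
  have Pj: "cmod (P j) \<le> (T + 1) * (L * real m ^ T)" if "j \<le> T" for j
  proof -
    have "cmod (P j) \<le> (\<Sum>i\<le>T. L * real m ^ T)"
      unfolding P_def
    proof (rule sum_norm_le)
      fix i assume "i \<in> {..T}"
      then have i: "i \<le> T" by simp
      have "\<bar>of_int (c i j)\<bar> * real m ^ i \<le> L * real m ^ T"
        using c(1)[OF i that] L m1 i by (intro mult_mono power_increasing) auto
      then show "cmod (of_int (c i j) * ?x ^ i) \<le> L * real m ^ T"
        by (simp add: norm_mult norm_power)
    qed
    then show ?thesis by (simp add: add.commute)
  qed
  let ?y = "w m"
  define K where "K = (T + 1) * (L * real m ^ T)"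
  have K0: "0 \<le> K" using L by (simp add: K_def)
  have y: "(T + 1) * K + 1 \<le> cmod ?y"
    using w[OF m(1)] by (simp only: K_def power2_eq_square of_nat_mult mult.assoc)
  then have y1: "1 \<le> cmod ?y" using K0 by (meson le_add_same_cancel2 mult_nonneg_nonneg of_nat_0_le_iff order_trans)
  have "bival T c ?x ?y = (\<Sum>j\<le>T. P j * ?y ^ j)"
    unfolding bival_def P_def by (subst sum.swap) (simp add: sum_distrib_right)
  also have "\<dots> = (\<Sum>j\<le>J. P j * ?y ^ j)"
  proof (rule sum.mono_neutral_right)
    show "\<forall>j\<in>{..T} - {..J}. P j * ?y ^ j = 0"
      using Jmax by (auto simp: P_def)
  qed (use J in auto)
  finally have biv: "bival T c ?x ?y = (\<Sum>j\<le>J. P j * ?y ^ j)" .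
  have "1 \<le> cmod (bival T c ?x ?y)"
  proof (cases J)
    case 0
    then show ?thesis using biv PJ by simp
  next
    case (Suc k)
    have split: "bival T c ?x ?y = (\<Sum>j\<le>k. P j * ?y ^ j) + P J * ?y ^ J"
      using biv Suc by simp
    have "cmod (\<Sum>j\<le>k. P j * ?y ^ j) \<le> (\<Sum>j\<le>k. K * cmod ?y ^ k)"
    proof (rule sum_norm_le)
      fix j assume "j \<in> {..k}"
      then have "j \<le> k" "j \<le> T" using Suc J(1) by auto
      then have "cmod (P j) * cmod ?y ^ j \<le> K * cmod ?y ^ k"
        using Pj y1 K0 unfolding K_def by (intro mult_mono power_increasing) auto
      then show "cmod (P j * ?y ^ j) \<le> K * cmod ?y ^ k" by (simp add: norm_mult norm_power)
    qed
    also have "\<dots> = (real k + 1) * K * cmod ?y ^ k" by simp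
    also have "\<dots> \<le> (T + 1) * K * cmod ?y ^ k"
      using Suc J(1) K0 by (intro mult_right_mono) auto
    finally have low: "cmod (\<Sum>j\<le>k. P j * ?y ^ j) \<le> (T + 1) * K * cmod ?y ^ k" .
    have "1 \<le> cmod ?y ^ k" using y1 by (rule one_le_power)
    also have "cmod ?y ^ k = 1 * cmod ?y ^ k" by simp
    also have "1 * cmod ?y ^ k \<le> (cmod ?y - (T + 1) * K) * cmod ?y ^ k"
      using y by (intro mult_right_mono) (linarith, simp)
    also have "\<dots> = cmod ?y ^ J - (T + 1) * K * cmod ?y ^ k" unfolding Suc power_Suc left_diff_distrib ..
    also have "\<dots> \<le> cmod (P J * ?y ^ J) - cmod (\<Sum>j\<le>k. P j * ?y ^ j)"
      using low mult_right_mono[OF PJ, of "cmod ?y ^ J"] by (simp add: norm_mult norm_power)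
    also have "\<dots> \<le> cmod (P J * ?y ^ J + (\<Sum>j\<le>k. P j * ?y ^ j))" by (rule norm_diff_ineq)
    also have "\<dots> = cmod (bival T c ?x ?y)" by (simp only: split add.commute)
    finally show ?thesis .
  qed
  then show ?thesis using m by blast
qed

text \<open>With \<open>T\<close> of order \<open>u\<close>, the nonvanishing step needs |f (- m)|
  to exceed exp (O (T u + T ln m)), and \<open>m\<close> of order \<open>u powr (4 / \<rho>)\<close>
  suffices. The Schwarz lemma on the disc of radius \<open>m\<close> then allows O (T m) zeros,
  which is the exponent \<open>1 + 4 / \<rho>\<close>.\<close>

lemma algebraic_points_count:
  fixes f :: "complex \<Rightarrow> complex" and d :: nat and S \<eta> r0 \<rho> :: real
  assumes f: "f holomorphic_on UNIV" "\<And>z. cmod (f z) \<le> exp (S * cmod z)" and S: "0 \<le> S"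
    and low: "0 < \<eta>" "1 \<le> r0" "\<And>x. r0 \<le> x \<Longrightarrow> exp (\<eta> * x powr \<rho>) \<le> cmod (f (- of_real x))"
    and rho: "0 < \<rho>" "\<rho> \<le> 1"
  shows "\<exists>C>0. \<forall>h u F. (1::nat) \<le> h \<longrightarrow> ln h \<le> u \<longrightarrow> 1 \<le> u \<longrightarrow> finite F \<longrightarrow>
     (\<forall>z\<in>F. cmod z \<le> u \<and> int_algebraic d h z \<and> int_algebraic d h (f z)) \<longrightarrow>
     real (card F) \<le> C * u powr (1 + 4 / \<rho>)"
proof -
  define D where "D = 4 * (d\<^sup>2 + 3)"
  define Y where "Y = 6 + 9 * (1 + S) + 8 * (real (d\<^sup>2) + 1)"
  \<comment> \<open>\<open>c5 * u\<close> bounds \<open>T + 1\<close>, \<open>c6 * u\<^sup>2\<close>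
    is the size that \<open>m powr (\<rho> / 2)\<close> has to reach, and \<open>c7\<close> bounds
    \<open>m\<close> in units of \<open>u powr (4 / \<rho>)\<close>.\<close>
  define c5 where "c5 = real D * (Y + 1)"
  define c6 where "c6 = c5 * (7 + 2 / \<rho>) / \<eta>"
  define c7 where "c7 = 2 + r0 + c6 powr (2 / \<rho>) + c5"
  define C where "C = real D * (Y + 1)\<^sup>2 + c5 * (6 + 9 * c7 * (1 + S))"
  have D: "1 \<le> D" by (simp add: D_def)
  have Y: "6 \<le> Y" using S by (simp add: Y_def)
  have c5: "0 < c5" using D Y by (simp add: c5_def)
  have c6: "0 < c6" using c5 low(1) rho unfolding c6_def by (intro divide_pos_pos mult_pos_pos add_pos_pos) auto
  have c7: "0 < c7" using low(2) c5 by (simp add: c7_def add_pos_nonneg add_nonneg_pos)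
  have C: "0 < C"
  proof -
    have "0 < 6 + 9 * c7 * (1 + S)" using c7 S by (intro add_pos_nonneg mult_nonneg_nonneg) auto
    then have "0 < c5 * (6 + 9 * c7 * (1 + S))" by (rule mult_pos_pos[OF c5])
    moreover have "0 < real D * (Y + 1)\<^sup>2" using D Y by (intro mult_pos_pos) auto
    ultimately show ?thesis unfolding C_def by (rule add_pos_pos[rotated])
  qed
  have "real (card F) \<le> C * u powr (1 + 4 / \<rho>)"
    if h: "1 \<le> h" "ln h \<le> u" and u: "1 \<le> u" and F: "finite F"
      "\<And>z. z \<in> F \<Longrightarrow> cmod z \<le> u \<and> int_algebraic d h z \<and> int_algebraic d h (f z)"
    for h :: nat and u :: real and F :: "complex set"
  proof -
    define M where "M = nat \<lceil>Y * u\<rceil>"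
    have Yu: "6 * 1 \<le> Y * u" using Y u by (intro mult_mono) auto
    have M: "Y * u \<le> real M" "real M \<le> Y * u + 1" using Yu by (simp_all add: M_def)
    have M1: "1 \<le> M" using M(1) Yu by linarith
    have Mu: "real M \<le> (Y + 1) * u" using M(2) u by (simp add: distrib_right)
    define T where "T = D * M - 1"
    have "1 * 1 \<le> D * M" using D M1 by (intro mult_le_mono) auto
    then have T: "T + 1 = D * M" by (simp add: T_def)
    have Tu: "real (T + 1) \<le> c5 * u"
    proof -
      have "real (T + 1) = real D * real M" unfolding T by (rule of_nat_mult)
      also have "\<dots> \<le> real D * ((Y + 1) * u)" using Mu by (intro mult_left_mono) auto
      finally show ?thesis by (simp only: c5_def mult.assoc)
    qed
    define U where "U = u powr (4 / \<rho>)"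
    have rho4: "1 \<le> 4 / \<rho>" using rho by (simp add: pos_le_divide_eq)
    have uU: "u \<le> U" using powr_mono[OF rho4 u] u by (simp add: U_def)
    have U1: "1 \<le> U" using uU u by linarith
    have uU': "u powr (1 + 4 / \<rho>) = u * U" using u by (simp add: U_def powr_add)
    show ?thesis
    proof (cases "D * M\<^sup>2 \<le> card F")
      \<comment> \<open>Too few points for the construction; but then there are only O (u^2) of
        them, and \<open>4 / \<rho> \<ge> 1\<close>.\<close>
      case False
      then have "real (card F) \<le> real (D * M\<^sup>2)" by (intro of_nat_mono) simp
      also have "\<dots> = real D * (real M)\<^sup>2" by simp
      also have "\<dots> \<le> real D * ((Y + 1) * u)\<^sup>2" using Mu by (intro mult_left_mono power_mono) auto
      also have "\<dots> = real D * (Y + 1)\<^sup>2 * (u * u)" by (simp only: power2_eq_square mult_ac)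
      also have "\<dots> \<le> C * (u * U)"
      proof (rule mult_mono)
        show "real D * (Y + 1)\<^sup>2 \<le> C" using c5 c7 S by (simp add: C_def)
        show "u * u \<le> u * U" using uU u by (intro mult_left_mono) auto
      qed (use C u in auto)
      finally show ?thesis by (simp only: uU')
    next
      case True
      have "\<exists>c. (\<forall>i\<le>T. \<forall>j\<le>T. \<bar>c i j\<bar> \<le> int ((T + 1)\<^sup>2 * h ^ (2 * T))) \<and>
          (\<exists>i\<le>T. \<exists>j\<le>T. c i j \<noteq> 0) \<and> (\<forall>z\<in>F. bival T c z (f z) = 0)"
      proof (rule exists_bival_vanishing_everywhere[OF f S h u M1 _ _ F(1)])
        show "(6 + 9 * (1 + S) + 8 * (d\<^sup>2 + 1)) * u \<le> real M" using M(1) by (simp add: Y_def)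
        show "T + 1 = 4 * (d\<^sup>2 + 3) * M" using T by (simp only: D_def)
        show "4 * (d\<^sup>2 + 3) * M\<^sup>2 \<le> card F" using True by (simp only: D_def)
      qed (use F(2) in blast)+
      then obtain c where c: "\<And>i j. i \<le> T \<Longrightarrow> j \<le> T \<Longrightarrow> \<bar>c i j\<bar> \<le> int ((T + 1)\<^sup>2 * h ^ (2 * T))"
        "\<exists>i\<le>T. \<exists>j\<le>T. c i j \<noteq> 0" and cF: "\<And>z. z \<in> F \<Longrightarrow> bival T c z (f z) = 0"
        by blast
      define L where "L = real ((T + 1)\<^sup>2 * h ^ (2 * T))"
      have Lexp: "L \<le> exp (2 * T * (1 + u))"
        unfolding L_def using h u S c(1)
        by (intro bival_norm_le_exp(2)[where R = 1 and S = 0 and z = 9 and w = 0 and c = c]) auto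
      \<comment> \<open>For \<open>m \<ge> V\<close> one factor \<open>m powr (\<rho> / 2)\<close>
        of \<open>m powr \<rho>\<close> is at least \<open>c6 * u\<^sup>2\<close>; the other one
        absorbs \<open>ln m\<close>.\<close>
      define V where "V = (c6 * u\<^sup>2) powr (2 / \<rho>)"
      have V: "V = c6 powr (2 / \<rho>) * U"
      proof -
        have "u\<^sup>2 = u powr 2" using u by simp
        then have "V = c6 powr (2 / \<rho>) * u powr (2 * (2 / \<rho>))"
          unfolding V_def using c6 u by (simp only: powr_mult powr_powr)
        then show ?thesis by (simp add: U_def)
      qed
      define m0 where "m0 = nat \<lceil>max (max u r0) V\<rceil>"
      have "max (max u r0) V \<le> real m0" unfolding m0_def by (rule real_nat_ceiling_ge)
      then have m0: "u \<le> real m0" "r0 \<le> real m0" "V \<le> real m0" by auto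
      have m0le: "real m0 \<le> (1 + r0 + c6 powr (2 / \<rho>) + 1) * U"
      proof -
        have "0 \<le> max (max u r0) V" using u by (simp add: le_max_iff_disj)
        then have "real m0 \<le> max (max u r0) V + 1" unfolding m0_def by linarith
        moreover have "0 \<le> V" by (simp add: V_def)
        ultimately have "real m0 \<le> u + r0 * 1 + V + 1 * 1" using u low(2) by linarith
        also have "\<dots> \<le> U + r0 * U + V + 1 * U" using uU U1 low(2) by (intro add_mono mult_left_mono) auto
        finally show ?thesis by (simp add: V algebra_simps)
      qed
      have m01: "1 \<le> m0" using m0(1) u by linarith
      have "\<exists>m\<ge>m0. m \<le> m0 + T \<and> 1 \<le> cmod (bival T c (- of_nat m) (f (- of_nat m)))"
      proof (rule bival_nonvanishing[OF _ c(2) m01])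
        show "real_of_int \<bar>c i j\<bar> \<le> L" if "i \<le> T" "j \<le> T" for i j
          unfolding L_def using c(1)[OF that] by linarith
        fix m assume m: "m0 \<le> m"
        then have mm: "1 \<le> real m" "r0 \<le> real m" "V \<le> real m" using m01 m0 by auto
        define Q where "Q = real m powr (\<rho> / 2)"
        have Q1: "1 \<le> Q" unfolding Q_def using mm(1) rho by (intro ge_one_powr_ge_zero) auto
        have Q2: "Q * Q = real m powr \<rho>" unfolding Q_def by (simp add: powr_add[symmetric])
        have "c6 * u\<^sup>2 = V powr (\<rho> / 2)" using c6 u rho by (simp add: V_def powr_powr)
        also have "\<dots> \<le> Q" unfolding Q_def using mm(3) rho by (intro powr_mono2) (auto simp: V_def)
        finally have Qc: "c6 * u\<^sup>2 \<le> Q" .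
        have W: "real (T + 1) * (5 + 2 / \<rho> + 2 * u) \<le> \<eta> * Q"
        proof -
          have "2 / \<rho> * 1 \<le> 2 / \<rho> * u" using u rho by (intro mult_left_mono) auto
          then have "5 + 2 / \<rho> + 2 * u \<le> 5 * u + 2 / \<rho> * u + 2 * u" using u by linarith
          also have "\<dots> = (7 + 2 / \<rho>) * u" by (simp add: algebra_simps)
          finally have "real (T + 1) * (5 + 2 / \<rho> + 2 * u) \<le> (c5 * u) * ((7 + 2 / \<rho>) * u)"
            using Tu c5 u rho by (intro mult_mono) auto
          also have "\<dots> = \<eta> * (c6 * u\<^sup>2)" using low(1) by (simp add: c6_def power2_eq_square)
          also have "\<dots> \<le> \<eta> * Q" using Qc low(1) by (intro mult_left_mono) auto
          finally show ?thesis .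
        qed
        have lnm: "ln (real m) \<le> Q / (\<rho> / 2)"
          unfolding Q_def using mm(1) rho by (intro ln_powr_bound) auto
        define e where "e = 2 * real T + 2 * T * (1 + u) + T * ln (real m)"
        have e0: "0 \<le> e" using u mm(1) by (simp add: e_def)
        have T2: "real ((T + 1)\<^sup>2) \<le> exp (2 * real T)"
        proof -
          have "(real T + 1)\<^sup>2 \<le> (exp (real T))\<^sup>2"
            using exp_ge_add_one_self[of "real T"] by (intro power_mono) linarith+
          then show ?thesis by (simp add: exp_double add.commute)
        qed
        have "real m = exp (ln (real m))" using mm(1) by simp
        then have "real m ^ T = exp (real T * ln (real m))" by (metis exp_of_nat_mult)
        then have "real ((T + 1)\<^sup>2) * L * real m ^ T \<le> exp (2 * real T) * exp (2 * T * (1 + u)) * exp (real T * ln (real m))"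
          using T2 Lexp by (intro mult_mono) (auto simp: L_def)
        also have "\<dots> = exp e" by (simp only: e_def exp_add)
        finally have "real ((T + 1)\<^sup>2) * L * real m ^ T + 1 \<le> exp e + 1" by simp
        also have "\<dots> \<le> exp e + exp e" using e0 by simp
        also have "\<dots> \<le> exp (e + 1)"
          using exp_ge_add_one_self[of "1::real"] mult_left_mono[of 2 "exp 1" "exp e"] by (simp add: exp_add)
        also have "\<dots> \<le> exp (\<eta> * real m powr \<rho>)"
        proof -
          have "ln (real m) \<le> 2 / \<rho> * Q" using lnm by (simp add: mult.commute)
          then have "T * ln (real m) \<le> T * (2 / \<rho> * Q)" by (intro mult_left_mono) auto
          then have "e + 1 \<le> (1 + 4 * T + 2 * T * u) * 1 + T * (2 / \<rho>) * Q"
            unfolding e_def by (simp add: algebra_simps)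
          also have "\<dots> \<le> ((T + 1) * (5 + 2 * u)) * Q + (T + 1) * (2 / \<rho>) * Q"
            using Q1 u rho by (intro add_mono mult_mono) (auto simp: algebra_simps)
          also have "\<dots> = real (T + 1) * (5 + 2 / \<rho> + 2 * u) * Q" by (simp add: algebra_simps)
          also have "\<dots> \<le> \<eta> * Q * Q" using W Q1 by (intro mult_right_mono) auto
          also have "\<dots> = \<eta> * real m powr \<rho>" by (simp only: Q2 mult.assoc)
          finally show ?thesis by (simp only: exp_le_cancel_iff)
        qed
        also have "\<dots> \<le> cmod (f (- of_nat m))" using low(3)[OF mm(2)] by simp
        finally show "real ((T + 1)\<^sup>2) * L * real m ^ T + 1 \<le> cmod (f (- of_nat m))" .
      qed
      then obtain m where m: "m0 \<le> m" "m \<le> m0 + T" "1 \<le> cmod (bival T c (- of_nat m) (f (- of_nat m)))"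
        by blast
      have um: "u \<le> real m" using m(1) m0(1) by (meson of_nat_le_iff order_trans)
      then have m1: "1 \<le> real m" using u by linarith
      \<comment> \<open>The Schwarz lemma read backwards: a value of modulus at least 1 limits the
        number of zeros by the growth on the circle of radius \<open>9 * m\<close>.\<close>
      have "cmod (bival T c (- of_nat m) (f (- of_nat m))) * 4 ^ card F \<le> exp (T * (4 + 2 * u + 9 * real m * (1 + S)))"
      proof (rule norm_le_of_zeros[where g = "\<lambda>z. bival T c z (f z)" and R = "real m"])
        show "F \<subseteq> cball 0 (real m)"
        proof
          fix z assume "z \<in> F"
          then have "cmod z \<le> real m" using F(2)[of z] um by linarith
          then show "z \<in> cball 0 (real m)" by simp
        qed
        show "(\<lambda>z. bival T c z (f z)) holomorphic_on UNIV" by (rule bival_holomorphic[OF f(1)])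
        show "cmod (bival T c y (f y)) \<le> exp (T * (4 + 2 * u + 9 * real m * (1 + S)))"
          if "cmod y = 9 * real m" for y
          by (rule bival_norm_le_exp(1)[OF c(1) h m1 S that f(2)])
      qed (use F(1) cF m1 in auto)
      moreover have "1 * 4 ^ card F \<le> cmod (bival T c (- of_nat m) (f (- of_nat m))) * 4 ^ card F"
        using m(3) by (intro mult_right_mono) auto
      moreover have "exp (real (card F)) \<le> 4 ^ card F" by (rule exp_le_4_power)
      ultimately have "exp (real (card F)) \<le> exp (T * (4 + 2 * u + 9 * real m * (1 + S)))" by linarith
      then have "real (card F) \<le> T * (4 + 2 * u + 9 * real m * (1 + S))" by (simp only: exp_le_cancel_iff)
      also have "\<dots> \<le> (c5 * u) * ((6 + 9 * c7 * (1 + S)) * U)"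
      proof (rule mult_mono)
        show "real T \<le> c5 * u" using Tu by simp
        have "real m \<le> real m0 + real T" using m(2) by (simp flip: of_nat_add)
        also have "\<dots> \<le> (1 + r0 + c6 powr (2 / \<rho>) + 1) * U + c5 * U"
        proof (rule add_mono[OF m0le])
          have "c5 * u \<le> c5 * U" using uU c5 by (intro mult_left_mono) auto
          then show "real T \<le> c5 * U" using Tu by simp
        qed
        also have "\<dots> = c7 * U" by (simp add: c7_def algebra_simps)
        finally have "9 * real m * (1 + S) \<le> 9 * (c7 * U) * (1 + S)"
          using S by (intro mult_right_mono mult_left_mono) auto
        moreover have "4 + 2 * u \<le> 6 * U" using uU U1 by linarith
        ultimately have "4 + 2 * u + 9 * real m * (1 + S) \<le> 6 * U + 9 * (c7 * U) * (1 + S)" by linarith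
        also have "\<dots> = (6 + 9 * c7 * (1 + S)) * U" by (simp add: algebra_simps)
        finally show "4 + 2 * u + 9 * real m * (1 + S) \<le> (6 + 9 * c7 * (1 + S)) * U" .
      qed (use c5 u S in auto)
      also have "\<dots> = (c5 * (6 + 9 * c7 * (1 + S))) * (u * U)" by (simp only: mult_ac)
      also have "\<dots> \<le> C * (u * U)"
        using D Y u U1 by (intro mult_right_mono) (auto simp: C_def)
      finally show ?thesis by (simp only: uU')
    qed
  qed
  then show ?thesis using C by blast
qed

section \<open>Passage to all points and to a bound in the logarithm of the height\<close>

lemma int_algebraic_mono: "int_algebraic d h x \<Longrightarrow> h \<le> h' \<Longrightarrow> int_algebraic d h' x"
  unfolding int_algebraic_def by (meson order_trans)

text \<open>\<open>card\<close> of an infinite set is 0, so finiteness needs its own proof; a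
  uniform bound on finite subsets supplies it, and the counting argument has to treat finite sets
  only.\<close>

lemma finite_card_le_of_finite_subsets:
  fixes B :: real
  assumes "\<And>F. finite F \<Longrightarrow> F \<subseteq> E \<Longrightarrow> real (card F) \<le> B"
  shows "finite E \<and> real (card E) \<le> B"
proof -
  have "finite E"
  proof (rule ccontr)
    assume "infinite E"
    then obtain F where "finite F" "card F = nat \<lceil>B\<rceil> + 1" "F \<subseteq> E"
      by (meson infinite_arbitrarily_large)
    then show False using assms[of F] by linarith
  qed
  then show ?thesis using assms by blast
qed

theorem theorem3p1:
  fixes a :: "nat \<Rightarrow> real"
    and f :: "complex \<Rightarrow> complex"
    and lam \<rho> \<mu> \<phi> \<alpha> \<beta> \<gamma> :: real
    and d :: nat
  assumes a_ge_1: "\<And>n. 1 \<le> a n"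
    and a_mono: "incseq a"
    and a_unbounded: "\<not> bdd_above (range a)"
    and a_summable: "summable (\<lambda>n. 1 / a n)"
    and f_eq: "\<And>z. f z = (\<Prod>n. 1 - z / complex_of_real (a n))"
    and lower_order_f: "growth_lower_order f = ereal lam"
    and order_f: "growth_order f = ereal \<rho>"
    and orders: "0 < lam" "lam \<le> \<rho>" "\<rho> \<le> 1 / 2"
    and density: "((\<lambda>r. real (counting_fun a r) / r powr \<rho>) \<longlongrightarrow> \<mu>) at_top"
    and density_pos: "0 < \<mu>"
    and phi: "0 < \<phi>" "\<phi> < pi / 2"
    and d: "1 \<le> d"
    and alpha: "\<alpha> = 1 + \<rho>"
    and beta: "\<beta> = lam / 2"
    and gamma: "\<gamma> = (2 * \<alpha> + \<rho>) / (\<beta> * \<rho>)"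
  shows "\<exists>C>0. \<forall>H>exp 1.
           finite {z. z \<notin> sector \<phi> \<and> degree_over_Q {z, f z} \<le> enat d \<and> alg_height2 z (f z) \<le> H} \<and>
           real (card {z. z \<notin> sector \<phi> \<and> degree_over_Q {z, f z} \<le> enat d \<and> alg_height2 z (f z) \<le> H})
             \<le> C * ln H powr (2 * \<alpha> * (\<gamma> + 1) / \<rho>)"
proof -
  have rho: "0 < \<rho>" using orders by linarith
  define S where "S = (\<Sum>n. 1 / a n)"
  have S: "0 \<le> S" unfolding S_def
  proof (rule suminf_nonneg[OF a_summable])
    show "0 \<le> 1 / a n" for n using a_ge_1[of n] by simp
  qed
  have hol: "f holomorphic_on UNIV" by (rule canonical_product_holomorphic[OF a_ge_1 a_summable f_eq])
  have up: "cmod (f z) \<le> exp (S * cmod z)" for z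
    unfolding S_def by (rule canonical_product_norm_le[OF a_ge_1 a_summable f_eq])
  obtain \<eta> r0 where \<eta>: "0 < \<eta>" and r0: "1 \<le> r0"
    and low: "\<And>z. z \<notin> sector \<phi> \<Longrightarrow> r0 \<le> cmod z \<Longrightarrow> exp (\<eta> * cmod z powr \<rho>) \<le> cmod (f z)"
    using canonical_product_lower_bound[OF a_ge_1 a_mono a_unbounded a_summable f_eq rho orders(3)
        density density_pos phi] by blast
  \<comment> \<open>The negative axis has argument \<pi> and lies off the sector; it carries the
    integers \<open>- m\<close> of the nonvanishing step.\<close>
  have "exp (\<eta> * x powr \<rho>) \<le> cmod (f (- of_real x))" if "r0 \<le> x" for x
  proof -
    have x: "0 < x" using that r0 by linarith
    then have "Arg (- complex_of_real x) = pi" by (simp add: Arg_minus)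
    then have "- complex_of_real x \<notin> sector \<phi>" using phi by (simp add: sector_def)
    then show ?thesis using low[of "- of_real x"] that x by simp
  qed
  then obtain C0 where C0: "0 < C0" and count: "\<And>h u F. (1::nat) \<le> h \<Longrightarrow> ln h \<le> u \<Longrightarrow> 1 \<le> u \<Longrightarrow> finite F \<Longrightarrow>
     (\<forall>z\<in>F. cmod z \<le> u \<and> int_algebraic d h z \<and> int_algebraic d h (f z)) \<Longrightarrow>
     real (card F) \<le> C0 * u powr (1 + 4 / \<rho>)"
    using algebraic_points_count[OF hol up S \<eta> r0, of \<rho> d] rho orders(3) by auto
  \<comment> \<open>Chosen so that \<open>ln h \<le> c1 * ln H\<close> below;
    \<open>ln H > 1\<close> absorbs the additive constants.\<close>
  define c1 where "c1 = ln (2 * (real d + 1)) + 2 * real d"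
  have c1: "0 < c1" using d by (simp add: c1_def add_nonneg_pos)
  \<comment> \<open>With \<open>u = K * ln H powr (1 / \<rho>)\<close> the entries ensure, in this
    order, that \<open>u\<close> is at least 1, at least \<open>ln h\<close>, at least the threshold
    \<open>r0\<close>, and at least the radius obtained from the growth estimate.\<close>
  define K where "K = Max {1, c1, r0, (c1 / \<eta>) powr (1 / \<rho>)}"
  have K: "1 \<le> K" "c1 \<le> K" "r0 \<le> K" "(c1 / \<eta>) powr (1 / \<rho>) \<le> K" by (simp_all add: K_def)
  define C where "C = C0 * K powr (1 + 4 / \<rho>)"
  have C: "0 < C" using C0 K(1) by (simp add: C_def)
  have exponent: "1 / \<rho> * (1 + 4 / \<rho>) \<le> 2 * \<alpha> * (\<gamma> + 1) / \<rho>"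
  proof -
    have \<beta>: "0 < \<beta>" "4 * \<beta> \<le> 1" using orders by (simp_all add: beta)
    \<comment> \<open>Here 4 \<beta> = 2 lam \<le> 1 \<le> 2 \<alpha> + \<rho>.\<close>
    have "4 / \<rho> \<le> \<gamma>"
    proof -
      have "4 / \<rho> = 4 * \<beta> / (\<beta> * \<rho>)" using \<beta> by simp
      also have "\<dots> \<le> (2 * \<alpha> + \<rho>) / (\<beta> * \<rho>)"
        using \<beta> rho by (intro divide_right_mono) (auto simp: alpha)
      finally show ?thesis by (simp only: gamma)
    qed
    moreover have "0 < 4 / \<rho>" using rho by simp
    ultimately have "0 \<le> \<gamma> + 1" by linarith
    then have "1 * (\<gamma> + 1) \<le> 2 * \<alpha> * (\<gamma> + 1)"
      using rho by (intro mult_right_mono) (auto simp: alpha)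
    moreover have "1 + 4 / \<rho> \<le> 1 * (\<gamma> + 1)" using \<open>4 / \<rho> \<le> \<gamma>\<close> by simp
    ultimately have "1 + 4 / \<rho> \<le> 2 * \<alpha> * (\<gamma> + 1)" by (rule order_trans[rotated])
    then have "(1 + 4 / \<rho>) / \<rho> \<le> 2 * \<alpha> * (\<gamma> + 1) / \<rho>" using rho by (intro divide_right_mono) auto
    then show ?thesis by simp
  qed
  show ?thesis
  proof (rule exI[of _ C], rule conjI[OF C], intro allI impI, rule finite_card_le_of_finite_subsets)
    fix H :: real and F
    assume H: "exp 1 < H" and F: "finite F"
      "F \<subseteq> {z. z \<notin> sector \<phi> \<and> degree_over_Q {z, f z} \<le> enat d \<and> alg_height2 z (f z) \<le> H}"
    have "(1::real) \<le> exp 1" by simp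
    then have H1: "1 \<le> H" and H0: "0 < H" using H by linarith+
    define l where "l = ln H"
    have "ln (exp 1) < ln H" using H H0 by (subst ln_less_cancel_iff) auto
    then have l: "1 < l" by (simp add: l_def)
    define h0 where "h0 = real (d + 1) * (2 * H) ^ d"
    \<comment> \<open>The pigeonhole argument counts integers up to a multiple of a power of
      \<open>h\<close>, so \<open>h\<close> is rounded up to a natural number; this costs at most a
      factor 2.\<close>
    define h where "h = nat \<lceil>h0\<rceil>"
    have "1 * 1 \<le> h0" unfolding h0_def using H1 by (intro mult_mono one_le_power) auto
    then have h0: "1 \<le> h0" by simp
    have h0h: "h0 \<le> real h" unfolding h_def by (rule real_nat_ceiling_ge)
    then have h1: "1 \<le> h" using h0 by linarith
    have hle: "real h \<le> 2 * h0" using h0 unfolding h_def by linarith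
    have lnh: "ln h \<le> c1 * l"
    proof -
      have "ln (real h) \<le> ln (2 * h0)" using hle h1 by (subst ln_le_cancel_iff) auto
      also have "2 * h0 = (2 * (real d + 1)) * (2 * H) ^ d" by (simp add: h0_def)
      also have "ln \<dots> = ln (2 * (real d + 1)) + d * (ln 2 + l)"
        using H0 by (simp add: ln_mult_pos ln_realpow l_def distrib_left)
      also have "\<dots> \<le> ln (2 * (real d + 1)) * l + d * (l + l)"
      proof (intro add_mono mult_left_mono)
        show "ln (2 * (real d + 1)) \<le> ln (2 * (real d + 1)) * l"
          using l mult_left_mono[of 1 l "ln (2 * (real d + 1))"] by simp
        show "ln 2 \<le> l" using ln_2_less_1 l by linarith
      qed auto
      also have "\<dots> = c1 * l" by (simp add: c1_def algebra_simps)
      finally show ?thesis .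
    qed
    define u where "u = K * l powr (1 / \<rho>)"
    have "1 \<le> 1 / \<rho>" using rho orders(3) by (simp add: pos_le_divide_eq)
    then have ll: "l \<le> l powr (1 / \<rho>)" using powr_mono[of 1 "1 / \<rho>" l] l by simp
    then have l1: "1 \<le> l powr (1 / \<rho>)" using l by linarith
    have Ku: "K \<le> u" unfolding u_def using K(1) l1 mult_left_mono[of 1 "l powr (1 / \<rho>)" K] by simp
    then have u1: "1 \<le> u" using K(1) by linarith
    have "c1 * l \<le> u" unfolding u_def using K(2) c1 l ll by (intro mult_mono) auto
    then have lnu: "ln h \<le> u" using lnh by linarith
    have pts: "cmod z \<le> u \<and> int_algebraic d h z \<and> int_algebraic d h (f z)" if z: "z \<in> F" for z
    proof -
      have z': "z \<notin> sector \<phi>" "degree_over_Q {z, f z} \<le> enat d" "alg_height z \<le> H" "alg_height (f z) \<le> H"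
        using z F(2) by (auto simp: alg_height2_def)
      have alg: "int_algebraic d h z" "int_algebraic d h (f z)"
        using int_algebraic_of_height[OF z'(2) _ z'(3) H1] int_algebraic_of_height[OF z'(2) _ z'(4) H1]
          h0h int_algebraic_mono unfolding h0_def by blast+
      \<comment> \<open>Being algebraic of bounded size, f z has modulus at most \<open>h\<close>;
        the growth off the sector turns this into a bound for the radius.\<close>
      have "cmod z \<le> u"
      proof (cases "r0 \<le> cmod z")
        case False
        then show ?thesis using K(3) Ku by linarith
      next
        case True
        have "exp (\<eta> * cmod z powr \<rho>) \<le> real h"
          using low[OF z'(1) True] int_algebraic_norm_le[OF alg(2)] by linarith
        then have "\<eta> * cmod z powr \<rho> \<le> ln h" using h1 by (subst ln_ge_iff) auto
        also have "\<dots> \<le> c1 * l" by (rule lnh)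
        finally have "cmod z powr \<rho> \<le> c1 * l / \<eta>" using \<eta> by (simp only: pos_le_divide_eq mult.commute)
        then have "(cmod z powr \<rho>) powr (1 / \<rho>) \<le> (c1 / \<eta> * l) powr (1 / \<rho>)"
          using rho by (intro powr_mono2) auto
        also have "\<dots> = (c1 / \<eta>) powr (1 / \<rho>) * l powr (1 / \<rho>)"
          by (rule powr_mult)
        also have "\<dots> \<le> u" unfolding u_def using K(4) by (intro mult_right_mono) auto
        also have "(cmod z powr \<rho>) powr (1 / \<rho>) = cmod z" using rho by (simp add: powr_powr)
        finally show ?thesis .
      qed
      then show ?thesis using alg by blast
    qed
    have "real (card F) \<le> C0 * u powr (1 + 4 / \<rho>)"
      using count[OF h1 lnu u1 F(1)] pts by blast
    also have "u powr (1 + 4 / \<rho>) = K powr (1 + 4 / \<rho>) * l powr (1 / \<rho> * (1 + 4 / \<rho>))"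
      unfolding u_def using K(1) l by (simp only: powr_mult powr_powr)
    also have "C0 * (K powr (1 + 4 / \<rho>) * l powr (1 / \<rho> * (1 + 4 / \<rho>))) = C * l powr (1 / \<rho> * (1 + 4 / \<rho>))"
      by (simp only: C_def mult.assoc)
    also have "\<dots> \<le> C * l powr (2 * \<alpha> * (\<gamma> + 1) / \<rho>)"
      using exponent C l by (intro mult_left_mono powr_mono) auto
    finally show "real (card F) \<le> C * ln H powr (2 * \<alpha> * (\<gamma> + 1) / \<rho>)" by (simp only: l_def)
  qed
qed

end
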